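(* Let $(\Omega,\Sigma,\mu)$ be a complete $\sigma$-finite measure space, let $E$ be a Köthe function space on $(\Omega,\Sigma,\mu)$, and let $X$ be a (real or complex) Banach space. Suppose that there is a dense subset $\mathcal{A}$ of $S_{E(X)}$ such that for every $f\in\mathcal{A}$ there is $\Phi_f\in E'(X^*,w^* )$ satisfying $\|\,|\Phi_f|\,\|_{E'}=\langle\Phi_f,f\rangle=1$. Then $$n\bigl(E(X)\bigr)\leq n(X).$$
   Context: For a Banach space $X$ (real or complex), $B_X$, $S_X$, $X^*$ denote its closed unit ball, unit sphere and dual, and $L(X)$ the bounded linear operators on $X$. Put $\Pi(X)=\{(x,x^* )\in S_X\times S_{X^*}: x^*(x)=1\}$. The numerical radius of $T\in L(X)$ is $v(T)=\sup\{|x^*(Tx)|:(x,x^* )\in\Pi(X)\}$, and the numerical index of $X$ is $n(X)=\inf\{v(T): T\in L(X),\ \|T\|=1\}$. $L_0(\mu)$ is the space of (a.e.-equivalence classes of) $\Sigma$-measurable locally integrable real-valued functions on $\Omega$ (locally integrable: integrable on every set of finite measure). A Köthe function space on $(\Omega,\Sigma,\mu)$ is a linear subspace $E$ of $L_0(\mu)$ with a complete norm $\|\cdot\|_E$ such that: (i) if $|f|\leq|g|$ a.e. on $\Omega$, $g\in E$ and $f\in L_0(\mu)$, then $f\in E$ and $\|f\|_E\leq\|g\|_E$; (ii) for every $A\in\Sigma$ with $0<\mu(A)<\infty$, the characteristic function $\chi_A$ belongs to $E$. The Köthe dual of $E$ is $E'=\{g\in L_0(\mu):\|g\|_{E'}:=\sup_{f\in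 B_E}\int_\Omega|fg|\,d\mu<\infty\}$. A function $f:\Omega\to X$ is strongly measurable if there is a sequence of simple functions (functions of the form $\sum_{i=1}^n x_i\chi_{A_i}$ with $x_i\in X$, $A_i\in\Sigma$) converging to $f$ in norm at almost every point of $\Omega$. $E(X)$ is the Banach space of (a.e. classes of) strongly measurable $f:\Omega\to X$ such that the function $t\mapsto\|f(t)\|_X$ belongs to $E$, with norm $\|f\|_{E(X)}=\bigl\|\,\|f(\cdot)\|_X\bigr\|_E$; it is real or complex depending on $X$. $E'(X^*,w^* )$ is the space of $w^*$-scalarly measurable functions $\Phi:\Omega\to X^*$ (i.e. $t\mapsto\langle\Phi(t),x\rangle$ is measurable for each $x\in X$) such that the function $|\Phi|:=\|\Phi(\cdot)\|_{X^*}$ belongs to $E'$; such $\Phi$ acts on $E(X)$ by $\langle\Phi,f\rangle=\int_\Omega\langle\Phi(t),f(t)\rangle\,d\mu(t)$ for $f\in E(X)$. *)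

theory Defs
  imports "HOL-Analysis.Analysis"
begin

text \<open>
  The scalar field is a type \<open>'k\<close> of sort \<open>{real_normed_field, euclidean_space}\<close>. Both
  \<open>real\<close> and \<open>complex\<close> have this sort, and the next lemma shows that there are no others
  up to isometric isomorphism.
\<close>

lemma scalars_real_or_complex:
  "(\<forall>z::'k::{real_normed_field,euclidean_space}. \<exists>a. z = of_real a) \<or>
   (\<exists>i::'k. i * i = - 1 \<and>
      (\<forall>z. \<exists>a b. z = of_real a + of_real b * i) \<and>
      (\<forall>a b. norm (of_real a + of_real b * i) = sqrt (a\<^sup>2 + b\<^sup>2)))"
proof -
  have dec: "z = of_real (inner z 1) + (z - of_real (inner z 1))"
            "inner (z - of_real (inner z 1)) 1 = 0" for z :: 'k
    by (simp_all add: inner_diff_left of_real_def norm_eq_1 [symmetric])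
  have sq: "u * u = - 1" if "inner u 1 = 0" "norm u = 1" for u :: 'k
  proof -
    have i1: "inner 1 u = 0" using that by (simp add: inner_commute)
    have n1: "inner (1::'k) 1 = 1" "inner u u = 1" 
      using that by (simp_all add: norm_eq_1 [symmetric])
    have "(norm (1 + u))\<^sup>2 = 2" "(norm (1 - u))\<^sup>2 = 2"
      using that i1 n1 by (simp_all add: power2_norm_eq_inner inner_simps)
    then have a: "(norm (1 - u * u))\<^sup>2 = 4"
    proof -
      assume *: "(norm (1 + u))\<^sup>2 = 2" "(norm (1 - u))\<^sup>2 = 2"
      have "1 - u * u = (1 + u) * (1 - u)" by (simp add: algebra_simps)
      then show ?thesis using * by (simp add: norm_mult power_mult_distrib)
    qed
    have uu: "inner (u * u) (u * u) = 1"
      using that by (simp add: norm_eq_1 [symmetric] norm_mult)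
    have "(norm (1 + u * u))\<^sup>2 + (norm (1 - u * u))\<^sup>2 = 4"
      using uu n1 by (simp add: power2_norm_eq_inner inner_simps)
    with a have "1 + u * u = 0" by simp
    then show ?thesis by (simp add: eq_neg_iff_add_eq_0 add.commute)
  qed
  show ?thesis
  proof (cases "\<forall>z::'k. z = of_real (inner z 1)")
    case True
    then show ?thesis by blast
  next
    case False
    then obtain w :: 'k where w: "w - of_real (inner w 1) \<noteq> 0" by auto
    define i where "i = (w - of_real (inner w 1)) /\<^sub>R norm (w - of_real (inner w 1))"
    have i: "inner i 1 = 0" "norm i = 1"
      using w dec(2)[of w] by (simp_all add: i_def)
    have ii: "i * i = - 1" using sq i by blast
    have "\<exists>b. z - of_real (inner z 1) = of_real b * i" for z
    proof -
      define v where "v = z - of_real (inner z 1)"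
      show ?thesis
      proof (cases "v = 0")
        case True
        then show ?thesis by (metis v_def mult_zero_left of_real_0)
      next
        case False
        define u where "u = v /\<^sub>R norm v"
        have "inner u 1 = 0" "norm u = 1"
          using False dec(2)[of z] by (simp_all add: u_def v_def)
        then have "u * u = i * i" using sq ii by metis
        then have "u = i \<or> u = - i" by (simp add: square_eq_iff)
        moreover have "v = of_real (norm v) * u"
          using False by (simp add: u_def scaleR_conv_of_real field_simps)
        ultimately have "v = of_real (norm v) * i \<or> v = of_real (- norm v) * i"
          by auto
        then show ?thesis unfolding v_def by blast
      qed
    qed
    then have "\<exists>a b. z = of_real a + of_real b * i" for z
      by (metis dec(1))
    moreover have "norm (of_real a + of_real b * i) = sqrt (a\<^sup>2 + b\<^sup>2)" for a b
    proof -
      have "inner i i = 1" "inner (1::'k) 1 = 1" "inner 1 i = 0"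
        using i by (simp_all add: norm_eq_1 [symmetric] inner_commute)
      then have "inner (a *\<^sub>R 1 + b *\<^sub>R i) (a *\<^sub>R 1 + b *\<^sub>R i) = a\<^sup>2 + b\<^sup>2"
        using i(1) by (simp add: inner_simps power2_eq_square)
      then have "(norm (a *\<^sub>R 1 + b *\<^sub>R i))\<^sup>2 = a\<^sup>2 + b\<^sup>2"
        by (simp only: power2_norm_eq_inner)
      moreover have "of_real a + of_real b * i = a *\<^sub>R 1 + b *\<^sub>R i"
        by (simp add: scaleR_conv_of_real)
      ultimately show ?thesis by (metis norm_ge_zero real_sqrt_unique)
    qed
    ultimately show ?thesis using ii by blast
  qed
qed

subsection \<open>Normed spaces with a carrier, numerical index\<close>

text \<open>
  The space \<open>E(X)\<close> depends on term parameters, so it cannot be a type; normed spaces are therefore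
  given by their data. Linear maps are compared on the carrier only, their values elsewhere are
  irrelevant.
\<close>

record ('k, 'v) nspace =
  carr :: "'v set"
  add :: "'v \<Rightarrow> 'v \<Rightarrow> 'v"
  scl :: "'k \<Rightarrow> 'v \<Rightarrow> 'v"
  nrm :: "'v \<Rightarrow> real"

definition type_space :: "('k \<Rightarrow> 'v \<Rightarrow> 'v) \<Rightarrow> ('k, 'v::real_normed_vector) nspace" where
  "type_space s = \<lparr>carr = UNIV, add = (+), scl = s, nrm = norm\<rparr>"

definition unit_ball :: "('k, 'v) nspace \<Rightarrow> 'v set" where
  "unit_ball V = {x \<in> carr V. nrm V x \<le> 1}"

definition unit_sphere :: "('k, 'v) nspace \<Rightarrow> 'v set" where
  "unit_sphere V = {x \<in> carr V. nrm V x = 1}"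

definition ndist :: "('k::ring_1, 'v) nspace \<Rightarrow> 'v \<Rightarrow> 'v \<Rightarrow> real" where
  "ndist V x y = nrm V (add V x (scl V (- 1) y))"

definition bounded_maps :: "('k, 'v) nspace \<Rightarrow> ('k, 'w) nspace \<Rightarrow> ('v \<Rightarrow> 'w) set" where
  "bounded_maps V W =
    {T. (\<forall>x\<in>carr V. T x \<in> carr W) \<and>
        (\<forall>x\<in>carr V. \<forall>y\<in>carr V. T (add V x y) = add W (T x) (T y)) \<and>
        (\<forall>c. \<forall>x\<in>carr V. T (scl V c x) = scl W c (T x)) \<and>
        (\<exists>C. \<forall>x\<in>carr V. nrm W (T x) \<le> C * nrm V x)}"

definition op_norm :: "('k, 'v) nspace \<Rightarrow> ('k, 'w) nspace \<Rightarrow> ('v \<Rightarrow> 'w) \<Rightarrow> real" where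
  "op_norm V W T = (SUP x\<in>unit_ball V. nrm W (T x))"

definition dual :: "('k::real_normed_field, 'v) nspace \<Rightarrow> ('v \<Rightarrow> 'k) set" where
  "dual V = bounded_maps V (type_space (*))"

definition dual_norm :: "('k::real_normed_field, 'v) nspace \<Rightarrow> ('v \<Rightarrow> 'k) \<Rightarrow> real" where
  "dual_norm V = op_norm V (type_space (*))"

definition state_pairs :: "('k::real_normed_field, 'v) nspace \<Rightarrow> ('v \<times> ('v \<Rightarrow> 'k)) set" where
  "state_pairs V = {(x, \<phi>). x \<in> unit_sphere V \<and> \<phi> \<in> dual V \<and> dual_norm V \<phi> = 1 \<and> \<phi> x = 1}"

definition numerical_radius :: "('k::real_normed_field, 'v) nspace \<Rightarrow> ('v \<Rightarrow> 'v) \<Rightarrow> real" where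
  "numerical_radius V T = (SUP (x, \<phi>)\<in>state_pairs V. norm (\<phi> (T x)))"

definition numerical_index :: "('k::real_normed_field, 'v) nspace \<Rightarrow> real" where
  "numerical_index V =
    (INF T\<in>{T \<in> bounded_maps V V. op_norm V V T = 1}. numerical_radius V T)"

text \<open>
  A Banach space over \<open>'k\<close>: completeness comes from the class \<open>banach\<close>, which records the
  underlying real Banach space.
\<close>

locale banach_over = vector_space scale
  for scale :: "'k::{real_normed_field,euclidean_space} \<Rightarrow> 'x::banach \<Rightarrow> 'x" +
  assumes norm_scale: "norm (scale c x) = norm c * norm x"
    and scale_of_real: "scale (of_real r) x = r *\<^sub>R x"

lemma banach_over_real: "banach_over (scaleR :: real \<Rightarrow> 'x::banach \<Rightarrow> 'x)"
  by unfold_locales (simp_all add: algebra_simps)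

lemma banach_over_complex: "banach_over ((*) :: complex \<Rightarrow> complex \<Rightarrow> complex)"
  by unfold_locales (simp_all add: algebra_simps norm_mult scaleR_conv_of_real)

subsection \<open>Koethe function spaces\<close>

text \<open>
  Real functions are not identified when they agree almost everywhere: \<open>E\<close> is the set of all
  representatives of the elements of a Koethe function space, and \<open>nE\<close> vanishes exactly on the null
  functions. By \<open>ideal\<close>, \<open>E\<close> and \<open>nE\<close> are invariant under a.e. equality.
\<close>

definition L0 :: "'a measure \<Rightarrow> ('a \<Rightarrow> real) set" where
  "L0 M = {f \<in> borel_measurable M.
            \<forall>A\<in>sets M. emeasure M A < \<infinity> \<longrightarrow> set_integrable M A f}"

locale koethe_space =
  fixes M :: "'a measure" and E :: "('a \<Rightarrow> real) set" and nE :: "('a \<Rightarrow> real) \<Rightarrow> real"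
  assumes subset_L0: "E \<subseteq> L0 M"
    and zero_mem: "(\<lambda>_. 0) \<in> E"
    and add_mem: "\<lbrakk>f \<in> E; g \<in> E\<rbrakk> \<Longrightarrow> (\<lambda>t. f t + g t) \<in> E"
    and scale_mem: "f \<in> E \<Longrightarrow> (\<lambda>t. c * f t) \<in> E"
    and norm_nonneg: "f \<in> E \<Longrightarrow> 0 \<le> nE f"
    and norm_eq_0_iff: "f \<in> E \<Longrightarrow> nE f = 0 \<longleftrightarrow> (AE t in M. f t = 0)"
    and norm_triangle: "\<lbrakk>f \<in> E; g \<in> E\<rbrakk> \<Longrightarrow> nE (\<lambda>t. f t + g t) \<le> nE f + nE g"
    and norm_scale: "f \<in> E \<Longrightarrow> nE (\<lambda>t. c * f t) = \<bar>c\<bar> * nE f"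
    and complete: "\<lbrakk>\<And>n::nat. F n \<in> E;
        \<And>e. e > 0 \<Longrightarrow> \<exists>N. \<forall>m\<ge>N. \<forall>n\<ge>N. nE (\<lambda>t. F m t - F n t) < e\<rbrakk>
        \<Longrightarrow> \<exists>f\<in>E. (\<lambda>n. nE (\<lambda>t. F n t - f t)) \<longlonglongrightarrow> 0"
    and ideal: "\<lbrakk>AE t in M. \<bar>f t\<bar> \<le> \<bar>g t\<bar>; g \<in> E; f \<in> L0 M\<rbrakk> \<Longrightarrow> f \<in> E \<and> nE f \<le> nE g"
    and indicator_mem: "\<lbrakk>A \<in> sets M; 0 < emeasure M A; emeasure M A < \<infinity>\<rbrakk>
        \<Longrightarrow> indicator A \<in> E"

definition koethe_dual_norm ::
  "'a measure \<Rightarrow> ('a \<Rightarrow> real) set \<Rightarrow> (('a \<Rightarrow> real) \<Rightarrow> real) \<Rightarrow> ('a \<Rightarrow> real) \<Rightarrow> ennreal" where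
  "koethe_dual_norm M E nE g = (SUP f\<in>{f \<in> E. nE f \<le> 1}. \<integral>\<^sup>+ t. ennreal \<bar>f t * g t\<bar> \<partial>M)"

definition koethe_dual ::
  "'a measure \<Rightarrow> ('a \<Rightarrow> real) set \<Rightarrow> (('a \<Rightarrow> real) \<Rightarrow> real) \<Rightarrow> ('a \<Rightarrow> real) set" where
  "koethe_dual M E nE = {g \<in> L0 M. koethe_dual_norm M E nE g < \<infinity>}"

subsection \<open>The spaces \<open>E(X)\<close> and \<open>E'(X\<^sup>*, w\<^sup>*)\<close>\<close>

definition strongly_measurable :: "'a measure \<Rightarrow> ('a \<Rightarrow> 'x::topological_space) \<Rightarrow> bool" where
  "strongly_measurable M f \<longleftrightarrow>
    (\<exists>s. (\<forall>n. simple_function M (s n)) \<and> (AE t in M. (\<lambda>n. s n t) \<longlonglongrightarrow> f t))"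

definition EX_fun :: "'a measure \<Rightarrow> ('a \<Rightarrow> real) set \<Rightarrow> ('a \<Rightarrow> 'x::real_normed_vector) set" where
  "EX_fun M E = {f. strongly_measurable M f \<and> (\<lambda>t. norm (f t)) \<in> E}"

definition ae_rel ::
  "'a measure \<Rightarrow> ('a \<Rightarrow> real) set \<Rightarrow> (('a \<Rightarrow> 'x::real_normed_vector) \<times> ('a \<Rightarrow> 'x)) set" where
  "ae_rel M E = {(f, g). f \<in> EX_fun M E \<and> g \<in> EX_fun M E \<and> (AE t in M. f t = g t)}"

text \<open>
  The operations on a.e. classes below do not depend on the representatives chosen by \<open>rep\<close>.
\<close>

definition rep :: "('a \<Rightarrow> 'x) set \<Rightarrow> 'a \<Rightarrow> 'x" where
  "rep F = (SOME f. f \<in> F)"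

definition EX_space ::
  "'a measure \<Rightarrow> ('a \<Rightarrow> real) set \<Rightarrow> (('a \<Rightarrow> real) \<Rightarrow> real) \<Rightarrow> ('k \<Rightarrow> 'x \<Rightarrow> 'x)
    \<Rightarrow> ('k, ('a \<Rightarrow> 'x::real_normed_vector) set) nspace" where
  "EX_space M E nE s =
    \<lparr>carr = EX_fun M E // ae_rel M E,
     add = (\<lambda>F G. ae_rel M E `` {\<lambda>t. rep F t + rep G t}),
     scl = (\<lambda>c F. ae_rel M E `` {\<lambda>t. s c (rep F t)}),
     nrm = (\<lambda>F. nE (\<lambda>t. norm (rep F t)))\<rparr>"

definition pt_norm ::
  "('k::real_normed_field \<Rightarrow> 'x::real_normed_vector \<Rightarrow> 'x) \<Rightarrow> ('a \<Rightarrow> 'x \<Rightarrow> 'k) \<Rightarrow> 'a \<Rightarrow> real" where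
  "pt_norm s \<Phi> = (\<lambda>t. dual_norm (type_space s) (\<Phi> t))"

definition weakstar_dual ::
  "'a measure \<Rightarrow> ('a \<Rightarrow> real) set \<Rightarrow> (('a \<Rightarrow> real) \<Rightarrow> real)
    \<Rightarrow> ('k::real_normed_field \<Rightarrow> 'x::real_normed_vector \<Rightarrow> 'x) \<Rightarrow> ('a \<Rightarrow> 'x \<Rightarrow> 'k) set" where
  "weakstar_dual M E nE s =
    {\<Phi>. (\<forall>t\<in>space M. \<Phi> t \<in> dual (type_space s)) \<and>
        (\<forall>x. (\<lambda>t. \<Phi> t x) \<in> borel_measurable M) \<and>
        pt_norm s \<Phi> \<in> koethe_dual M E nE}"

definition pairing ::
  "'a measure \<Rightarrow> ('a \<Rightarrow> 'x \<Rightarrow> 'k::{real_normed_field,euclidean_space}) \<Rightarrow> ('a \<Rightarrow> 'x) set \<Rightarrow> 'k" where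
  "pairing M \<Phi> F = (\<integral>t. \<Phi> t (rep F t) \<partial>M)"

end

theory Submission
  imports Defs
begin

text \<open>
  An operator \<open>T\<close> on \<open>X\<close> acts pointwise on \<open>E(X)\<close>: the operator \<open>lift T\<close> maps \<open>f\<close> to
  \<open>T \<circ> f\<close>. Testing it on the functions \<open>e x\<close> with a fixed scalar function \<open>e\<close> of norm one shows
  that \<open>lift T\<close> has norm one when \<open>T\<close> has (\<open>op_norm_lift\<close>). Hence the theorem follows as soon as
  \<open>v(lift T) \<le> v(T)\<close>, and this is the lemma \<open>numerical_radius_lift_le\<close>. Write \<open>w = v(T)\<close>.

  Let \<open>f\<close> be a function in \<open>\<A>\<close> and let \<open>\<Phi>\<close> norm it. Then
  \<open>1 = \<integral> \<Phi>(t)(f(t)) \<le> \<integral> \<bar>\<Phi>\<bar>(t) \<parallel>f(t)\<parallel> \<le> 1\<close>, and equality throughout forces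
  \<open>\<Phi>(t)(f(t)) = \<bar>\<Phi>\<bar>(t) \<parallel>f(t)\<parallel>\<close> almost everywhere (\<open>norming_pointwise\<close>). So wherever
  \<open>\<bar>\<Phi>\<bar>(t) \<parallel>f(t)\<parallel> \<noteq> 0\<close>, the pair \<open>(f(t), \<Phi>(t))\<close> is, after normalization, a point of \<open>\<Pi>(X)\<close>, and
  \<open>\<bar>\<Phi>(t)(T f(t))\<bar> \<le> w \<bar>\<Phi>\<bar>(t) \<parallel>f(t)\<parallel>\<close>.

  This controls \<open>lift T\<close> only on one supporting functional for each \<open>f\<close> in a dense set, whereas
  \<open>v(lift T)\<close> involves all states of \<open>E(X)\<close>. The passage from one to the other is Lumer's
  argument: the estimate above gives, for every scalar \<open>c\<close>, the lower bound
  \<open>\<parallel>f + c (lift T) f\<parallel> \<ge> (1 - \<bar>c\<bar> w) \<parallel>f\<parallel>\<close> (\<open>norming_lower_bound\<close>), which no longer mentions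
  functionals. It extends by density to all \<open>f\<close> in \<open>E(X)\<close> (\<open>lower_bound_from_dense\<close>), and such
  lower bounds imply that the numerical radius is at most \<open>w\<close>
  (\<open>numerical_radius_le_from_lower_bounds\<close>).

  The pairing with \<open>\<Phi>\<close> is itself a state of \<open>E(X)\<close> supported at \<open>f\<close> (\<open>pairing_state\<close>), so
  \<open>\<Pi>(E(X))\<close> is not empty. This matters because the supremum of the empty set of reals is an
  unknown number.
\<close>

section \<open>Numerical ranges in normed spaces with a carrier\<close>

text \<open>
  The record of a normed space has no field for the zero vector. Here \<open>scl V 0 y\<close> takes its place,
  and the axioms say that it is neutral whatever \<open>y\<close> is.
\<close>

locale normed_nspace =
  fixes V :: "('k::real_normed_field, 'v) nspace"
  assumes add_closed: "\<lbrakk>x \<in> carr V; y \<in> carr V\<rbrakk> \<Longrightarrow> add V x y \<in> carr V"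
    and scl_closed: "x \<in> carr V \<Longrightarrow> scl V c x \<in> carr V"
    and add_assoc: "\<lbrakk>x \<in> carr V; y \<in> carr V; z \<in> carr V\<rbrakk>
          \<Longrightarrow> add V (add V x y) z = add V x (add V y z)"
    and add_commute: "\<lbrakk>x \<in> carr V; y \<in> carr V\<rbrakk> \<Longrightarrow> add V x y = add V y x"
    and scl_add: "\<lbrakk>x \<in> carr V; y \<in> carr V\<rbrakk>
          \<Longrightarrow> scl V c (add V x y) = add V (scl V c x) (scl V c y)"
    and add_scl: "x \<in> carr V \<Longrightarrow> add V (scl V a x) (scl V b x) = scl V (a + b) x"
    and scl_scl: "x \<in> carr V \<Longrightarrow> scl V a (scl V b x) = scl V (a * b) x"
    and scl_one: "x \<in> carr V \<Longrightarrow> scl V 1 x = x"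
    and add_scl_zero: "\<lbrakk>x \<in> carr V; y \<in> carr V\<rbrakk> \<Longrightarrow> add V x (scl V 0 y) = x"
    and nrm_nonneg: "x \<in> carr V \<Longrightarrow> 0 \<le> nrm V x"
    and nrm_scl: "x \<in> carr V \<Longrightarrow> nrm V (scl V c x) = norm c * nrm V x"
    and nrm_add: "\<lbrakk>x \<in> carr V; y \<in> carr V\<rbrakk> \<Longrightarrow> nrm V (add V x y) \<le> nrm V x + nrm V y"
begin

lemma add_left_commute:
  "\<lbrakk>x \<in> carr V; y \<in> carr V; z \<in> carr V\<rbrakk> \<Longrightarrow> add V x (add V y z) = add V y (add V x z)"
  by (metis add_assoc add_commute)

lemma bdd_above_op:
  fixes W :: "('k, 'w) nspace"
  assumes "T \<in> bounded_maps V W"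
  shows "bdd_above ((\<lambda>x. nrm W (T x)) ` unit_ball V)"
proof -
  obtain C where C: "\<forall>x\<in>carr V. nrm W (T x) \<le> C * nrm V x"
    using assms by (auto simp: bounded_maps_def)
  have "nrm W (T x) \<le> \<bar>C\<bar>" if "x \<in> unit_ball V" for x
  proof -
    have x: "x \<in> carr V" "nrm V x \<le> 1" "0 \<le> nrm V x"
      using that nrm_nonneg by (auto simp: unit_ball_def)
    have "nrm W (T x) \<le> C * nrm V x" using C x by auto
    also have "\<dots> \<le> \<bar>C\<bar> * 1" using x by (intro mult_mono) auto
    finally show ?thesis by simp
  qed
  then show ?thesis by (auto intro!: bdd_aboveI)
qed

lemma nrm_le_op_norm:
  fixes W :: "('k, 'w) nspace"
  assumes W: "normed_nspace W" and T: "T \<in> bounded_maps V W" and x: "x \<in> carr V"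
  shows "nrm W (T x) \<le> op_norm V W T * nrm V x"
proof (cases "nrm V x = 0")
  case True
  obtain C where "\<forall>x\<in>carr V. nrm W (T x) \<le> C * nrm V x"
    using T by (auto simp: bounded_maps_def)
  then show ?thesis using True x by fastforce
next
  case False
  define r where "r = nrm V x"
  have r: "r > 0" using False nrm_nonneg[OF x] by (simp add: r_def)
  define y where "y = scl V (of_real (1 / r)) x"
  have y: "y \<in> unit_ball V"
    using x r by (simp add: y_def unit_ball_def scl_closed nrm_scl norm_divide flip: r_def)
  have Tx: "T x \<in> carr W" using T x by (auto simp: bounded_maps_def)
  have "nrm W (T x) / r = nrm W (T y)"
    using T x r by (simp add: y_def bounded_maps_def normed_nspace.nrm_scl[OF W Tx] norm_divide)
  also have "\<dots> \<le> op_norm V W T"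
    unfolding op_norm_def by (rule cSUP_upper[OF y bdd_above_op[OF T]])
  finally show ?thesis using r by (simp add: r_def field_simps)
qed

lemma normed_nspace_scalars: "normed_nspace (type_space ((*) :: 'k \<Rightarrow> 'k \<Rightarrow> 'k))"
  by unfold_locales (simp_all add: type_space_def algebra_simps norm_mult norm_triangle_ineq)

lemma norm_le_dual_norm:
  assumes "\<phi> \<in> dual V" "x \<in> carr V"
  shows "norm (\<phi> x) \<le> dual_norm V \<phi> * nrm V x"
  using nrm_le_op_norm[OF normed_nspace_scalars, of \<phi> x] assms
  by (simp add: dual_def dual_norm_def type_space_def)

lemma norm_state_le:
  assumes "(x, \<phi>) \<in> state_pairs V" "y \<in> carr V"
  shows "norm (\<phi> y) \<le> nrm V y"
  using norm_le_dual_norm[of \<phi> y] assms by (simp add: state_pairs_def)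

text \<open>
  Suprema of unbounded sets of reals are meaningless, so every upper bound by
  \<open>numerical_radius\<close> rests on the next fact.
\<close>

lemma bdd_above_numerical_radius:
  assumes T: "T \<in> bounded_maps V V"
  shows "bdd_above ((\<lambda>(x, \<phi>). norm (\<phi> (T x))) ` state_pairs V)"
proof -
  have "norm (\<phi> (T x)) \<le> op_norm V V T" if p: "(x, \<phi>) \<in> state_pairs V" for x \<phi>
  proof -
    have x: "x \<in> carr V" "nrm V x = 1" using p by (auto simp: state_pairs_def unit_sphere_def)
    have "T x \<in> carr V" using T x by (auto simp: bounded_maps_def)
    then have "norm (\<phi> (T x)) \<le> nrm V (T x)" using norm_state_le[OF p] by blast
    also have "\<dots> \<le> op_norm V V T"
      using nrm_le_op_norm[OF normed_nspace_axioms T x(1)] x by simp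
    finally show ?thesis .
  qed
  then show ?thesis by (auto intro!: bdd_aboveI)
qed

lemma le_numerical_radius:
  assumes "T \<in> bounded_maps V V" "(x, \<phi>) \<in> state_pairs V"
  shows "norm (\<phi> (T x)) \<le> numerical_radius V T"
  using cSUP_upper[OF assms(2) bdd_above_numerical_radius[OF assms(1)]]
  by (simp add: numerical_radius_def)

lemma numerical_radius_nonneg:
  assumes "T \<in> bounded_maps V V" "state_pairs V \<noteq> {}"
  shows "0 \<le> numerical_radius V T"
  using assms le_numerical_radius by (metis ex_in_conv norm_ge_zero order_trans surj_pair)

lemma numerical_index_le:
  assumes "T \<in> bounded_maps V V" "op_norm V V T = 1" "state_pairs V \<noteq> {}"
  shows "numerical_index V \<le> numerical_radius V T"
  unfolding numerical_index_def
proof (rule cINF_lower)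
  show "bdd_below (numerical_radius V ` {T \<in> bounded_maps V V. op_norm V V T = 1})"
    using numerical_radius_nonneg assms(3) by (intro bdd_belowI[of _ 0]) auto
qed (use assms in simp)

text \<open>
  On a zero space no operator has norm \<open>1\<close>, so the infimum defining the numerical index runs over
  the empty set, and \<open>Inf {}\<close> is some real number that cannot be computed. It does not depend on
  the space, which is all that comparing two zero spaces requires.
\<close>

lemma numerical_index_trivial:
  assumes "carr V \<noteq> {}" "\<And>x. x \<in> carr V \<Longrightarrow> nrm V x = 0"
  shows "numerical_index V = Inf {}"
proof -
  have "op_norm V V T = 0" if T: "T \<in> bounded_maps V V" for T
  proof -
    have "unit_ball V \<noteq> {}" using assms by (auto simp: unit_ball_def)
    moreover have "nrm V (T x) = 0" if "x \<in> unit_ball V" for x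
      using T that assms(2) by (auto simp: unit_ball_def bounded_maps_def)
    ultimately show ?thesis by (simp add: op_norm_def cong: SUP_cong_simp image_cong_simp)
  qed
  then have "{T \<in> bounded_maps V V. op_norm V V T = 1} = {}" by auto
  then show ?thesis unfolding numerical_index_def by (simp only: image_empty)
qed

text \<open>
  Both sides are continuous in \<open>x\<close>, as \<open>P = 1 + c T\<close> is bounded, and absolutely homogeneous. So
  the estimate passes from a dense subset to the unit sphere, and from there to the whole space by
  scaling.
\<close>

lemma lower_bound_from_dense:
  assumes T: "T \<in> bounded_maps V V"
    and AS: "A \<subseteq> unit_sphere V"
    and dense: "\<forall>x\<in>unit_sphere V. \<forall>e>0. \<exists>g\<in>A. ndist V x g < e"
    and lower: "\<And>g. g \<in> A \<Longrightarrow> r \<le> nrm V (add V g (scl V c (T g)))"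
    and x: "x \<in> carr V"
  shows "r * nrm V x \<le> nrm V (add V x (scl V c (T x)))"
proof -
  define P where "P x = add V x (scl V c (T x))" for x
  obtain C where C: "\<forall>x\<in>carr V. nrm V (T x) \<le> C * nrm V x"
    using T by (auto simp: bounded_maps_def)
  have Tcarr: "T x \<in> carr V" if "x \<in> carr V" for x
    using T that by (auto simp: bounded_maps_def)
  have Tadd: "T (add V x y) = add V (T x) (T y)" if "x \<in> carr V" "y \<in> carr V" for x y
    using T that by (auto simp: bounded_maps_def)
  have Tscl: "T (scl V a x) = scl V a (T x)" if "x \<in> carr V" for x a
    using T that by (auto simp: bounded_maps_def)
  have Pcarr: "P x \<in> carr V" if "x \<in> carr V" for x
    using that by (simp add: P_def add_closed scl_closed Tcarr)
  have Padd: "P (add V x y) = add V (P x) (P y)" if "x \<in> carr V" "y \<in> carr V" for x y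
    using that by (simp add: P_def Tadd scl_add add_closed scl_closed Tcarr add_assoc
        add_commute add_left_commute)
  have Pscl: "P (scl V a x) = scl V a (P x)" if "x \<in> carr V" for x a
    using that by (simp add: P_def Tscl scl_add scl_scl add_closed scl_closed Tcarr mult.commute)
  define K where "K = 1 + norm c * \<bar>C\<bar>"
  have K: "K > 0" by (simp add: K_def add_pos_nonneg)
  have Pbound: "nrm V (P x) \<le> K * nrm V x" if x: "x \<in> carr V" for x
  proof -
    have "nrm V (T x) \<le> \<bar>C\<bar> * nrm V x"
      using C x nrm_nonneg[OF x] by (meson abs_ge_self mult_right_mono order_trans)
    then have "norm c * nrm V (T x) \<le> norm c * (\<bar>C\<bar> * nrm V x)"
      by (rule mult_left_mono) simp
    then show ?thesis
      using nrm_add[OF x scl_closed[OF Tcarr[OF x]], of c] x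
      by (simp add: P_def K_def nrm_scl Tcarr algebra_simps)
  qed
  have sphere: "r \<le> nrm V (P x)" if x: "x \<in> unit_sphere V" for x
  proof (rule field_le_epsilon)
    fix e :: real assume "e > 0"
    then obtain g where g: "g \<in> A" "ndist V x g < e / K"
      using dense x K by (meson divide_pos_pos)
    have xc: "x \<in> carr V" and gc: "g \<in> carr V"
      using x g AS by (auto simp: unit_sphere_def)
    (* The approximant g is x + d with d small, so P g is close to P x. *)
    define d where "d = add V g (scl V (- 1) x)"
    have d: "d \<in> carr V" using xc gc by (simp add: d_def add_closed scl_closed)
    have self: "add V y (scl V (- 1) y) = scl V 0 y" if "y \<in> carr V" for y
      using add_scl[OF that, of 1 "- 1"] that by (simp add: scl_one)
    have "g = add V g (add V x (scl V (- 1) x))"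
      using xc gc by (simp add: self add_scl_zero)
    also have "\<dots> = add V x d"
      using xc gc by (simp add: d_def add_left_commute scl_closed)
    finally have gd: "g = add V x d" .
    have "d = scl V (- 1) (add V x (scl V (- 1) g))"
      using xc gc by (simp add: d_def scl_add scl_scl scl_closed scl_one add_commute)
    then have "nrm V d = ndist V x g"
      using xc gc by (simp add: nrm_scl ndist_def add_closed scl_closed)
    then have "K * nrm V d \<le> e" using g(2) K by (simp add: field_simps)
    moreover have "r \<le> nrm V (P g)" using lower[OF g(1)] by (simp add: P_def)
    moreover have "nrm V (P g) \<le> nrm V (P x) + nrm V (P d)"
      unfolding gd using xc d by (simp add: Padd nrm_add Pcarr)
    ultimately show "r \<le> nrm V (P x) + e" using Pbound[OF d] by linarith
  qed
  show ?thesis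
  proof (cases "nrm V x = 0")
    case True
    then show ?thesis using nrm_nonneg[OF Pcarr[OF x]] by (simp add: P_def)
  next
    case False
    then have n: "nrm V x > 0" using nrm_nonneg[OF x] by simp
    have "scl V (of_real (1 / nrm V x)) x \<in> unit_sphere V"
      using n x by (simp add: unit_sphere_def scl_closed nrm_scl norm_divide)
    from sphere[OF this] show ?thesis
      using n x by (simp add: Pscl nrm_scl Pcarr norm_divide field_simps flip: P_def)
  qed
qed

text \<open>
  Lumer's argument. Given a state \<open>(x, \<phi>)\<close> and \<open>z = \<phi>(T x)\<close>, choose \<open>c\<close> with \<open>\<bar>c\<bar> = a\<close> and
  \<open>c z = a \<bar>z\<bar>\<close>, and put \<open>y = x + c T x\<close>. The state sees that \<open>y\<close> is long:
  \<open>\<parallel>y\<parallel> \<ge> \<bar>\<phi>(y)\<bar> = 1 + a \<bar>z\<bar>\<close>. But applying \<open>1 - c T\<close> to \<open>y\<close> cancels the first-order terms and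
  leaves \<open>x - c\<^sup>2 T\<^sup>2 x\<close>, of norm \<open>1 + O(a\<^sup>2)\<close>. As \<open>1 - c T\<close> shrinks norms at most by the factor
  \<open>1 - a w\<close>, the product \<open>(1 - a w)(1 + a \<bar>z\<bar>)\<close> is at most \<open>1 + O(a\<^sup>2)\<close>, and comparing the terms
  of first order as \<open>a\<close> tends to \<open>0\<close> yields \<open>\<bar>z\<bar> \<le> w\<close>.
\<close>

lemma numerical_radius_le_from_lower_bounds:
  assumes T: "T \<in> bounded_maps V V"
    and w: "0 \<le> w"
    and lower: "\<And>c x. x \<in> carr V \<Longrightarrow>
          (1 - norm c * w) * nrm V x \<le> nrm V (add V x (scl V c (T x)))"
    and ne: "state_pairs V \<noteq> {}"
  shows "numerical_radius V T \<le> w"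
proof -
  obtain C where C: "\<forall>x\<in>carr V. nrm V (T x) \<le> C * nrm V x"
    using T by (auto simp: bounded_maps_def)
  have Tcarr: "T x \<in> carr V" if "x \<in> carr V" for x
    using T that by (auto simp: bounded_maps_def)
  have Tadd: "T (add V x y) = add V (T x) (T y)" if "x \<in> carr V" "y \<in> carr V" for x y
    using T that by (auto simp: bounded_maps_def)
  have Tscl: "T (scl V a x) = scl V a (T x)" if "x \<in> carr V" for x a
    using T that by (auto simp: bounded_maps_def)
  have "norm (\<phi> (T x)) \<le> w" if p: "(x, \<phi>) \<in> state_pairs V" for x \<phi>
  proof (cases "\<phi> (T x) = 0")
    case True
    then show ?thesis using w by simp
  next
    case False
    define z where "z = \<phi> (T x)"
    have z: "z \<noteq> 0" using False by (simp add: z_def)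
    have x: "x \<in> carr V" "nrm V x = 1" "\<phi> x = 1" and phi: "\<phi> \<in> dual V"
      using p by (auto simp: state_pairs_def unit_sphere_def)
    have \<phi>add: "\<phi> (add V u v) = \<phi> u + \<phi> v" if "u \<in> carr V" "v \<in> carr V" for u v
      using phi that by (auto simp: dual_def bounded_maps_def type_space_def)
    have \<phi>scl: "\<phi> (scl V a u) = a * \<phi> u" if "u \<in> carr V" for u a
      using phi that by (auto simp: dual_def bounded_maps_def type_space_def)
    define B where "B = nrm V (T (T x))"
    have key: "norm z - w \<le> a * (B + w * norm z)"
      if a: "a > 0" "a * w \<le> 1" for a
    proof -
      define c where "c = of_real (a * norm z) / z"
      have nc: "norm c = a" using z a by (simp add: c_def norm_divide norm_mult)
      define y where "y = add V x (scl V c (T x))"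
      have y: "y \<in> carr V" using x by (simp add: y_def add_closed scl_closed Tcarr)
      have "\<phi> y = 1 + c * z" using x by (simp add: y_def \<phi>add \<phi>scl scl_closed Tcarr z_def)
      also have "\<dots> = of_real (1 + a * norm z)" using z by (simp add: c_def)
      finally have "norm (\<phi> y) = 1 + a * norm z" using a
        by (metis abs_of_nonneg add_nonneg_nonneg less_imp_le mult_nonneg_nonneg norm_ge_zero
            norm_of_real zero_le_one)
      then have "1 + a * norm z \<le> nrm V y" using norm_state_le[OF p y] by simp
      then have "(1 - a * w) * (1 + a * norm z) \<le> (1 - a * w) * nrm V y"
        using a by (intro mult_left_mono) auto
      also have "\<dots> \<le> nrm V (add V y (scl V (- c) (T y)))"
        using lower[OF y, of "- c"] nc by simp
      also have "add V y (scl V (- c) (T y)) = add V x (scl V (- c * c) (T (T x)))"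
      proof -
        have tx: "T x \<in> carr V" and ttx: "T (T x) \<in> carr V" using x Tcarr by auto
        have "scl V (- c) (T y) = add V (scl V (- c) (T x)) (scl V (- c * c) (T (T x)))"
          using x tx ttx by (simp add: y_def Tadd Tscl scl_add scl_scl scl_closed)
        then have "add V y (scl V (- c) (T y)) =
            add V x (add V (add V (scl V c (T x)) (scl V (- c) (T x))) (scl V (- c * c) (T (T x))))"
          using x tx ttx by (simp add: y_def add_assoc add_closed scl_closed)
        also have "\<dots> = add V x (scl V (- c * c) (T (T x)))"
          using x tx ttx by (simp add: add_scl add_commute[of "scl V 0 (T x)"] scl_closed add_scl_zero)
        finally show ?thesis .
      qed
      also have "nrm V (add V x (scl V (- c * c) (T (T x)))) \<le> 1 + a * a * B"
        using nrm_add[OF x(1) scl_closed[of "T (T x)" "- c * c"]] x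
        by (simp add: Tcarr nrm_scl norm_mult nc B_def)
      finally have "a * (norm z - w) \<le> a * (a * (B + w * norm z))"
        by (simp add: algebra_simps)
      then show ?thesis using a by simp
    qed
    have "norm z - w \<le> 0"
    proof (rule tendsto_lowerbound)
      show "((\<lambda>a. a * (B + w * norm z)) \<longlongrightarrow> 0) (at_right 0)"
        by (auto intro!: tendsto_eq_intros)
      have "eventually (\<lambda>a::real. a * w < 1) (at_right 0)"
        by (rule order_tendstoD[of _ 0]) (auto intro!: tendsto_eq_intros)
      then show "eventually (\<lambda>a. norm z - w \<le> a * (B + w * norm z)) (at_right 0)"
        using eventually_at_right_less[of "0::real"]
        by eventually_elim (use key in auto)
    qed simp
    then show ?thesis by (simp add: z_def)
  qed
  then show ?thesis unfolding numerical_radius_def using ne by (intro cSUP_least) auto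
qed

end

section \<open>Strongly measurable functions on a complete measure space\<close>

text \<open>
  A sequence that converges almost everywhere converges everywhere after it has been made constant
  on a null set. The two limits differ only on that set, so their preimages differ by subsets of
  null sets, which completeness of the measure makes measurable.
\<close>

lemma (in complete_measure) borel_measurable_AE_LIMSEQ:
  fixes f :: "nat \<Rightarrow> 'a \<Rightarrow> 'b::metric_space"
  assumes f: "\<And>n. f n \<in> borel_measurable M"
    and lim: "AE t in M. (\<lambda>n. f n t) \<longlonglongrightarrow> g t"
  shows "g \<in> borel_measurable M"
proof -
  obtain N where N: "\<And>t. t \<in> space M - N \<Longrightarrow> (\<lambda>n. f n t) \<longlonglongrightarrow> g t" "N \<in> null_sets M"
    using AE_E3[OF lim] by blast
  have [measurable]: "N \<in> sets M" using N by auto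
  define h where "h t = (if t \<in> N then undefined else g t)" for t
  have h: "h \<in> borel_measurable M"
  proof (rule borel_measurable_LIMSEQ_metric)
    show "(\<lambda>t. if t \<in> N then undefined else f n t) \<in> borel_measurable M" for n
      using f[of n] by measurable
    show "(\<lambda>n. if t \<in> N then undefined else f n t) \<longlonglongrightarrow> h t" if "t \<in> space M" for t
      using that N by (auto simp: h_def)
  qed
  have ae: "AE t in M. h t = g t"
    using AE_not_in[OF N(2)] by eventually_elim (simp add: h_def)
  show ?thesis
  proof (rule measurableI)
    fix A :: "'b set" assume A: "A \<in> sets borel"
    show "g -` A \<inter> space M \<in> sets M"
      using ae by (intro in_sets_AE[OF _ measurable_sets[OF h A]]) auto
  qed simp
qed

lemma strongly_measurable_add:
  fixes f g :: "'a \<Rightarrow> 'x::real_normed_vector"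
  assumes "strongly_measurable M f" "strongly_measurable M g"
  shows "strongly_measurable M (\<lambda>t. f t + g t)"
proof -
  obtain u v where u: "\<forall>n. simple_function M (u n)" "AE t in M. (\<lambda>n. u n t) \<longlonglongrightarrow> f t"
    and v: "\<forall>n. simple_function M (v n)" "AE t in M. (\<lambda>n. v n t) \<longlonglongrightarrow> g t"
    using assms unfolding strongly_measurable_def by auto
  have "simple_function M (\<lambda>t. u n t + v n t)" for n
    using u(1) v(1) simple_function_compose2[of M "u n" "v n" "(+)"] by blast
  moreover have "AE t in M. (\<lambda>n. u n t + v n t) \<longlonglongrightarrow> f t + g t"
    using u(2) v(2) by eventually_elim (rule tendsto_add)
  ultimately show ?thesis
    unfolding strongly_measurable_def by (intro exI[of _ "\<lambda>n t. u n t + v n t"]) simp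
qed

lemma strongly_measurable_bounded_linear:
  assumes "strongly_measurable M f" "bounded_linear h"
  shows "strongly_measurable M (\<lambda>t. h (f t))"
proof -
  obtain u where u: "\<forall>n. simple_function M (u n)" "AE t in M. (\<lambda>n. u n t) \<longlonglongrightarrow> f t"
    using assms unfolding strongly_measurable_def by auto
  have "simple_function M (\<lambda>t. h (u n t))" for n
    using simple_function_compose[of M "u n" h] u(1) by (simp add: comp_def)
  moreover have "AE t in M. (\<lambda>n. h (u n t)) \<longlonglongrightarrow> h (f t)"
    using u(2) by eventually_elim (rule bounded_linear.tendsto[OF assms(2)])
  ultimately show ?thesis
    unfolding strongly_measurable_def by (intro exI[of _ "\<lambda>n t. h (u n t)"]) simp
qed

lemma (in complete_measure) borel_measurable_strongly_measurable:
  fixes f :: "'a \<Rightarrow> 'x::metric_space"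
  assumes "strongly_measurable M f"
  shows "f \<in> borel_measurable M"
proof -
  obtain u where u: "\<forall>n. simple_function M (u n)" "AE t in M. (\<lambda>n. u n t) \<longlonglongrightarrow> f t"
    using assms unfolding strongly_measurable_def by auto
  show ?thesis
    using u(1) borel_measurable_AE_LIMSEQ[OF borel_measurable_simple_function u(2)] by blast
qed

text \<open>
  Although \<open>\<Phi>\<close> is measurable only when tested on fixed vectors, a simple function takes finitely
  many values, so \<open>\<Phi>(t)(u(t))\<close> is a finite sum of measurable functions when \<open>u\<close> is simple.
  Continuity of each \<open>\<Phi>(t)\<close> then carries measurability over to limits of simple functions.
\<close>

lemma (in complete_measure) borel_measurable_weakstar_pairing:
  fixes \<Phi> :: "'a \<Rightarrow> 'x::real_normed_vector \<Rightarrow> 'k::euclidean_space"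
  assumes f: "strongly_measurable M f"
    and \<Phi>: "\<And>x. (\<lambda>t. \<Phi> t x) \<in> borel_measurable M"
    and lin: "\<And>t. t \<in> space M \<Longrightarrow> bounded_linear (\<Phi> t)"
  shows "(\<lambda>t. \<Phi> t (f t)) \<in> borel_measurable M"
proof -
  obtain u where u: "\<forall>n. simple_function M (u n)" "AE t in M. (\<lambda>n. u n t) \<longlonglongrightarrow> f t"
    using f unfolding strongly_measurable_def by auto
  show ?thesis
  proof (rule borel_measurable_AE_LIMSEQ)
    show "AE t in M. (\<lambda>n. \<Phi> t (u n t)) \<longlonglongrightarrow> \<Phi> t (f t)"
      using u(2) by (rule AE_mp) (auto intro!: AE_I2 bounded_linear.tendsto[OF lin])
    show "(\<lambda>t. \<Phi> t (u n t)) \<in> borel_measurable M" for n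
    proof -
      have fin: "finite (u n ` space M)" and meas: "\<And>y. u n -` {y} \<inter> space M \<in> sets M"
        using u(1) by (auto simp: simple_functionD)
      have "(\<lambda>t. \<Sum>y\<in>u n ` space M. indicat_real (u n -` {y} \<inter> space M) t *\<^sub>R \<Phi> t y)
              \<in> borel_measurable M"
        using meas \<Phi> by measurable
      also have "?this \<longleftrightarrow> (\<lambda>t. \<Phi> t (u n t)) \<in> borel_measurable M"
      proof (rule measurable_cong)
        fix t assume t: "t \<in> space M"
        have "(\<Sum>y\<in>u n ` space M. indicat_real (u n -` {y} \<inter> space M) t *\<^sub>R \<Phi> t y)
            = (\<Sum>y\<in>u n ` space M. if y = u n t then \<Phi> t y else 0)"
          using t by (intro sum.cong) (auto simp: indicator_def)
        also have "\<dots> = \<Phi> t (u n t)" using fin t by (subst sum.delta) auto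
        finally show "(\<Sum>y\<in>u n ` space M. indicat_real (u n -` {y} \<inter> space M) t *\<^sub>R \<Phi> t y)
            = \<Phi> t (u n t)" .
      qed
      finally show ?thesis .
    qed
  qed
qed

section \<open>Banach spaces over the scalar field\<close>

lemma banach_over_scalars:
  "banach_over ((*) :: 'k::{real_normed_field,euclidean_space} \<Rightarrow> 'k \<Rightarrow> 'k)"
  by unfold_locales (simp_all add: algebra_simps norm_mult scaleR_conv_of_real)

lemma bounded_linear_bounded_maps:
  assumes "banach_over s" "banach_over s'"
    and T: "T \<in> bounded_maps (type_space s) (type_space s')"
  shows "bounded_linear T"
proof -
  obtain C where C: "\<And>x. norm (T x) \<le> C * norm x"
    using T by (auto simp: bounded_maps_def type_space_def)
  show ?thesis
  proof (rule bounded_linear_intro)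
    show "T (x + y) = T x + T y" for x y
      using T by (simp add: bounded_maps_def type_space_def)
    show "T (r *\<^sub>R x) = r *\<^sub>R T x" for r x
    proof -
      have "T (s (of_real r) x) = s' (of_real r) (T x)"
        using T by (simp add: bounded_maps_def type_space_def)
      then show ?thesis by (simp add: banach_over.scale_of_real assms(1,2))
    qed
    show "norm (T x) \<le> norm x * C" for x using C[of x] by (simp add: mult.commute)
  qed
qed

lemma (in banach_over) normed_nspace_type_space: "normed_nspace (type_space scale)"
  by unfold_locales
     (simp_all add: type_space_def algebra_simps norm_scale norm_triangle_ineq
        scale_right_distrib scale_left_distrib)

lemma (in banach_over) bounded_linear_scale: "bounded_linear (scale c)"
proof (rule bounded_linear_intro)
  show "scale c (r *\<^sub>R x) = r *\<^sub>R scale c x" for r x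
    by (simp flip: scale_of_real add: mult.commute)
  show "norm (scale c x) \<le> norm x * norm c" for x by (simp add: norm_scale mult.commute)
qed (rule scale_right_distrib)

section \<open>The Banach-space-valued function space as a normed space\<close>

lemma L0_dominated:
  assumes "u \<in> borel_measurable M" "g \<in> L0 M" "AE t in M. \<bar>u t\<bar> \<le> \<bar>g t\<bar>"
  shows "u \<in> L0 M"
  unfolding L0_def
proof (intro CollectI conjI ballI impI)
  fix A assume A: "A \<in> sets M" "emeasure M A < \<infinity>"
  have "integrable M (\<lambda>x. indicat_real A x *\<^sub>R g x)"
    using assms(2) A by (auto simp: L0_def set_integrable_def)
  then show "set_integrable M A u"
    unfolding set_integrable_def
    by (rule Bochner_Integration.integrable_bound)
       (use A assms(1,3) in \<open>auto simp: abs_mult indicator_def elim!: eventually_mono\<close>)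
qed (fact assms(1))

locale koethe_bochner =
  complete_measure M + E: koethe_space M E nE + X: banach_over s
  for M :: "'a measure" and E nE
    and s :: "'k::{real_normed_field,euclidean_space} \<Rightarrow> 'x::banach \<Rightarrow> 'x"
begin

abbreviation cls :: "('a \<Rightarrow> 'x) \<Rightarrow> ('a \<Rightarrow> 'x) set" where
  "cls f \<equiv> ae_rel M E `` {f}"

abbreviation V :: "('k, ('a \<Rightarrow> 'x) set) nspace" where
  "V \<equiv> EX_space M E nE s"

text \<open>
  The ideal property of \<open>E\<close>, lifted to vector-valued functions. It is the source of all membership
  statements in \<open>E(X)\<close> below.
\<close>

lemma EX_dominated:
  assumes f: "strongly_measurable M f" and g: "g \<in> E" and le: "AE t in M. norm (f t) \<le> \<bar>g t\<bar>"
  shows "f \<in> EX_fun M E" and "nE (\<lambda>t. norm (f t)) \<le> nE g"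
proof -
  have "(\<lambda>t. norm (f t)) \<in> borel_measurable M"
    using borel_measurable_strongly_measurable[OF f] by measurable
  then have "(\<lambda>t. norm (f t)) \<in> L0 M"
    using L0_dominated[of _ M g] le g E.subset_L0 by auto
  then have "(\<lambda>t. norm (f t)) \<in> E \<and> nE (\<lambda>t. norm (f t)) \<le> nE g"
    using le g by (intro E.ideal) auto
  then show "f \<in> EX_fun M E" "nE (\<lambda>t. norm (f t)) \<le> nE g"
    using f by (auto simp: EX_fun_def)
qed

lemma EX_strongly_measurable: "f \<in> EX_fun M E \<Longrightarrow> strongly_measurable M f"
  and EX_norm_mem: "f \<in> EX_fun M E \<Longrightarrow> (\<lambda>t. norm (f t)) \<in> E"
  by (simp_all add: EX_fun_def)

lemma EX_add:
  assumes "f \<in> EX_fun M E" "g \<in> EX_fun M E"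
  shows "(\<lambda>t. f t + g t) \<in> EX_fun M E"
    and "nE (\<lambda>t. norm (f t + g t)) \<le> nE (\<lambda>t. norm (f t)) + nE (\<lambda>t. norm (g t))"
proof -
  have sm: "strongly_measurable M (\<lambda>t. f t + g t)"
    using assms by (auto intro: strongly_measurable_add EX_strongly_measurable)
  have mem: "(\<lambda>t. norm (f t) + norm (g t)) \<in> E"
    using assms by (auto intro: E.add_mem EX_norm_mem)
  have le: "AE t in M. norm (f t + g t) \<le> \<bar>norm (f t) + norm (g t)\<bar>"
    by (rule AE_I2) (metis abs_ge_self norm_triangle_ineq order_trans)
  show "(\<lambda>t. f t + g t) \<in> EX_fun M E" by (rule EX_dominated[OF sm mem le])
  have "nE (\<lambda>t. norm (f t + g t)) \<le> nE (\<lambda>t. norm (f t) + norm (g t))"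
    by (rule EX_dominated[OF sm mem le])
  then show "nE (\<lambda>t. norm (f t + g t)) \<le> nE (\<lambda>t. norm (f t)) + nE (\<lambda>t. norm (g t))"
    using E.norm_triangle[OF EX_norm_mem[OF assms(1)] EX_norm_mem[OF assms(2)]] by linarith
qed

lemma EX_bounded_linear:
  assumes f: "f \<in> EX_fun M E" and h: "bounded_linear h" and C: "\<And>x. norm (h x) \<le> C * norm x"
  shows "(\<lambda>t. h (f t)) \<in> EX_fun M E"
    and "nE (\<lambda>t. norm (h (f t))) \<le> \<bar>C\<bar> * nE (\<lambda>t. norm (f t))"
proof -
  have sm: "strongly_measurable M (\<lambda>t. h (f t))"
    using f h by (auto intro: strongly_measurable_bounded_linear EX_strongly_measurable)
  have mem: "(\<lambda>t. C * norm (f t)) \<in> E"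
    using f by (auto intro: E.scale_mem EX_norm_mem)
  have le: "AE t in M. norm (h (f t)) \<le> \<bar>C * norm (f t)\<bar>"
    by (rule AE_I2) (metis C abs_ge_self order_trans)
  show "(\<lambda>t. h (f t)) \<in> EX_fun M E" by (rule EX_dominated[OF sm mem le])
  show "nE (\<lambda>t. norm (h (f t))) \<le> \<bar>C\<bar> * nE (\<lambda>t. norm (f t))"
    using EX_dominated(2)[OF sm mem le] f by (simp add: E.norm_scale EX_norm_mem)
qed

lemma EX_scale:
  assumes "f \<in> EX_fun M E"
  shows "(\<lambda>t. s c (f t)) \<in> EX_fun M E"
  by (rule EX_bounded_linear[OF assms X.bounded_linear_scale, of c "norm c"])
     (simp add: X.norm_scale)

lemma equiv_ae_rel: "equiv (EX_fun M E :: ('a \<Rightarrow> 'x) set) (ae_rel M E)"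
proof (rule equivI)
  show "ae_rel M E \<subseteq> EX_fun M E \<times> (EX_fun M E :: ('a \<Rightarrow> 'x) set)"
    by (auto simp: ae_rel_def)
  show "refl_on (EX_fun M E :: ('a \<Rightarrow> 'x) set) (ae_rel M E)"
    by (auto simp: ae_rel_def refl_on_def)
  show "sym (ae_rel M E :: (('a \<Rightarrow> 'x) \<times> _) set)"
    by (auto simp: ae_rel_def sym_def elim: eventually_mono)
  show "trans (ae_rel M E :: (('a \<Rightarrow> 'x) \<times> _) set)"
  proof (rule transI)
    fix f g h :: "'a \<Rightarrow> 'x"
    assume fg: "(f, g) \<in> ae_rel M E" and gh: "(g, h) \<in> ae_rel M E"
    then have "AE t in M. f t = g t" "AE t in M. g t = h t" by (auto simp: ae_rel_def)
    then have "AE t in M. f t = h t" by eventually_elim simp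
    then show "(f, h) \<in> ae_rel M E" using fg gh by (auto simp: ae_rel_def)
  qed
qed

lemma cls_eqI:
  assumes "f \<in> EX_fun M E" "g \<in> EX_fun M E" "AE t in M. f t = g t"
  shows "cls f = cls g"
  using eq_equiv_class_iff[OF equiv_ae_rel assms(1,2)] assms by (auto simp: ae_rel_def)

lemma cls_mem: "f \<in> EX_fun M E \<Longrightarrow> cls f \<in> carr V"
  by (simp add: EX_space_def quotientI)

lemma carrE:
  assumes "F \<in> carr V"
  obtains f where "f \<in> EX_fun M E" "F = cls f"
  using assms by (auto simp: EX_space_def elim: quotientE)

text \<open>
  From here on, the operations on classes, which are given by chosen representatives, can be
  computed with arbitrary representatives.
\<close>

lemma rep_cls:
  assumes "f \<in> EX_fun M E"
  shows "rep (cls f) \<in> EX_fun M E" and "AE t in M. rep (cls f) t = f t"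
proof -
  have "f \<in> cls f" using assms by (simp add: ae_rel_def)
  then have "rep (cls f) \<in> cls f" unfolding rep_def by (rule someI[where P = "\<lambda>h. h \<in> cls f"])
  then show "rep (cls f) \<in> EX_fun M E" "AE t in M. rep (cls f) t = f t"
    by (auto simp: ae_rel_def elim: eventually_mono)
qed

lemma rep_mem: "F \<in> carr V \<Longrightarrow> rep F \<in> EX_fun M E"
  by (metis carrE rep_cls(1))

lemma cls_rep: "F \<in> carr V \<Longrightarrow> cls (rep F) = F"
  by (metis carrE cls_eqI rep_cls)

lemma add_cls:
  assumes "f \<in> EX_fun M E" "g \<in> EX_fun M E"
  shows "add V (cls f) (cls g) = cls (\<lambda>t. f t + g t)"
  unfolding EX_space_def nspace.simps
proof (rule cls_eqI)
  show "AE t in M. rep (cls f) t + rep (cls g) t = f t + g t"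
    using rep_cls(2)[OF assms(1)] rep_cls(2)[OF assms(2)] by eventually_elim simp
qed (use assms in \<open>simp_all add: EX_add rep_cls\<close>)

lemma scl_cls:
  assumes "f \<in> EX_fun M E"
  shows "scl V c (cls f) = cls (\<lambda>t. s c (f t))"
  unfolding EX_space_def nspace.simps
proof (rule cls_eqI)
  show "AE t in M. s c (rep (cls f) t) = s c (f t)"
    using rep_cls(2)[OF assms(1)] by eventually_elim simp
qed (use assms in \<open>simp_all add: EX_scale rep_cls\<close>)

lemma nrm_cls:
  assumes "f \<in> EX_fun M E"
  shows "nrm V (cls f) = nE (\<lambda>t. norm (f t))"
proof -
  have "AE t in M. norm (rep (cls f) t) \<le> \<bar>norm (f t)\<bar>"
    and "AE t in M. norm (f t) \<le> \<bar>norm (rep (cls f) t)\<bar>"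
    using rep_cls(2)[OF assms] by (auto elim: eventually_mono)
  then show ?thesis
    unfolding EX_space_def nspace.simps using assms rep_cls(1)[OF assms]
    by (intro antisym EX_dominated(2)) (auto simp: EX_strongly_measurable EX_norm_mem)
qed

lemma nrm_rep: "F \<in> carr V \<Longrightarrow> nE (\<lambda>t. norm (rep F t)) = nrm V F"
  by (simp add: EX_space_def)

sublocale normed_nspace V
proof
  fix x y z :: "('a \<Rightarrow> 'x) set" and a b c :: 'k
  assume x: "x \<in> carr V"
  obtain f where f: "f \<in> EX_fun M E" "x = cls f" using carrE[OF x] .
  note simps = f add_cls scl_cls nrm_cls EX_add(1) EX_scale cls_mem
  show "scl V c x \<in> carr V" by (simp add: simps)
  show "add V (scl V a x) (scl V b x) = scl V (a + b) x"
    by (simp add: simps X.scale_left_distrib)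
  show "scl V a (scl V b x) = scl V (a * b) x" by (simp add: simps)
  show "scl V 1 x = x" by (simp add: simps)
  show "0 \<le> nrm V x" by (simp add: simps E.norm_nonneg EX_norm_mem)
  show "nrm V (scl V c x) = norm c * nrm V x"
    using E.norm_scale[of "\<lambda>t. norm (f t)" "norm c"] by (simp add: simps X.norm_scale EX_norm_mem)
  assume y: "y \<in> carr V"
  obtain g where g: "g \<in> EX_fun M E" "y = cls g" using carrE[OF y] .
  show "add V x y \<in> carr V" by (simp add: simps g)
  show "add V x y = add V y x" by (simp add: simps g add.commute)
  show "scl V c (add V x y) = add V (scl V c x) (scl V c y)"
    by (simp add: simps g X.scale_right_distrib)
  show "add V x (scl V 0 y) = x"
    using EX_scale[OF g(1), of 0] by (simp add: simps g)
  show "nrm V (add V x y) \<le> nrm V x + nrm V y" by (simp add: simps g EX_add(2))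
  assume z: "z \<in> carr V"
  obtain h where h: "h \<in> EX_fun M E" "z = cls h" using carrE[OF z] .
  show "add V (add V x y) z = add V x (add V y z)" by (simp add: simps g h add.assoc)
qed

section \<open>Koethe duality and norming functionals\<close>

text \<open>
  Hoelder's inequality for the unit ball of the Koethe dual. The definition of the dual norm only
  speaks of functions in the unit ball of \<open>E\<close>; the general case is obtained by scaling, and a
  function of norm zero vanishes almost everywhere.
\<close>

lemma integrable_koethe_dual:
  assumes h: "h \<in> E" and g: "g \<in> borel_measurable M" and le: "koethe_dual_norm M E nE g \<le> 1"
  shows "integrable M (\<lambda>t. h t * g t)" and "(\<integral>t. \<bar>h t * g t\<bar> \<partial>M) \<le> nE h"
proof -
  have [measurable]: "h \<in> borel_measurable M" "g \<in> borel_measurable M"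
    using h g E.subset_L0 by (auto simp: L0_def)
  have n: "(\<integral>\<^sup>+t. ennreal \<bar>h t * g t\<bar> \<partial>M) \<le> ennreal (nE h)"
  proof (cases "nE h = 0")
    case True
    then have "AE t in M. h t = 0" using E.norm_eq_0_iff[OF h] by simp
    then have "AE t in M. ennreal \<bar>h t * g t\<bar> = 0" by eventually_elim simp
    then have "(\<integral>\<^sup>+t. ennreal \<bar>h t * g t\<bar> \<partial>M) = 0" by (subst nn_integral_0_iff_AE) auto
    then show ?thesis by simp
  next
    case False
    then have r: "nE h > 0" using E.norm_nonneg[OF h] by simp
    have "(\<lambda>t. 1 / nE h * h t) \<in> {f \<in> E. nE f \<le> 1}"
      using r E.scale_mem[OF h, of "1 / nE h"] E.norm_scale[OF h, of "1 / nE h"] by simp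
    then have "(\<integral>\<^sup>+t. ennreal \<bar>(1 / nE h * h t) * g t\<bar> \<partial>M) \<le> koethe_dual_norm M E nE g"
      unfolding koethe_dual_norm_def by (rule SUP_upper)
    then have le1: "(\<integral>\<^sup>+t. ennreal \<bar>(1 / nE h * h t) * g t\<bar> \<partial>M) \<le> 1" using le by simp
    have "(\<integral>\<^sup>+t. ennreal \<bar>h t * g t\<bar> \<partial>M)
        = (\<integral>\<^sup>+t. ennreal (nE h) * ennreal \<bar>(1 / nE h * h t) * g t\<bar> \<partial>M)"
      using r by (intro nn_integral_cong) (simp add: abs_mult flip: ennreal_mult)
    also have "\<dots> = ennreal (nE h) * (\<integral>\<^sup>+t. ennreal \<bar>(1 / nE h * h t) * g t\<bar> \<partial>M)"
      by (rule nn_integral_cmult) measurable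
    also have "\<dots> \<le> ennreal (nE h) * 1" by (rule mult_left_mono[OF le1]) simp
    finally show ?thesis by simp
  qed
  show I: "integrable M (\<lambda>t. h t * g t)"
    by (rule integrableI_bounded) (use n in \<open>auto simp: less_top[symmetric] top_unique\<close>)
  have "ennreal (\<integral>t. \<bar>h t * g t\<bar> \<partial>M) = (\<integral>\<^sup>+t. ennreal \<bar>h t * g t\<bar> \<partial>M)"
    using I by (intro nn_integral_eq_integral[symmetric]) auto
  then show "(\<integral>t. \<bar>h t * g t\<bar> \<partial>M) \<le> nE h"
    using n E.norm_nonneg[OF h] by (metis ennreal_le_iff)
qed

lemma dual_bound:
  assumes "\<phi> \<in> dual (type_space s)"
  shows "norm (\<phi> x) \<le> dual_norm (type_space s) \<phi> * norm x"
  using normed_nspace.norm_le_dual_norm[OF X.normed_nspace_type_space assms, of x]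
  by (simp add: type_space_def)

lemma dual_bounded_linear: "\<phi> \<in> dual (type_space s) \<Longrightarrow> bounded_linear \<phi>"
  unfolding dual_def
  by (rule bounded_linear_bounded_maps[OF X.banach_over_axioms banach_over_scalars])

lemma dual_scale: "\<phi> \<in> dual (type_space s) \<Longrightarrow> \<phi> (s c x) = c * \<phi> x"
  by (simp add: dual_def bounded_maps_def type_space_def)

text \<open>
  Where \<open>\<phi>\<close> attains its norm at \<open>x\<close>, both can be normalized to a state of \<open>X\<close>, unless one of
  them is zero and the claim is trivial. This is the form in which the states of \<open>X\<close> enter the
  estimate under the integral.
\<close>

lemma norm_le_numerical_radius_times:
  assumes T: "T \<in> bounded_maps (type_space s) (type_space s)"
    and \<phi>: "\<phi> \<in> dual (type_space s)"
    and eq: "\<phi> x = of_real (dual_norm (type_space s) \<phi> * norm x)"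
  shows "norm (\<phi> (T x))
    \<le> numerical_radius (type_space s) T * (dual_norm (type_space s) \<phi> * norm x)"
proof -
  define d where "d = dual_norm (type_space s) \<phi>"
  have lT: "bounded_linear T"
    by (rule bounded_linear_bounded_maps[OF X.banach_over_axioms X.banach_over_axioms T])
  have l\<phi>: "bounded_linear \<phi>" using \<phi> by (rule dual_bounded_linear)
  have b: "norm (\<phi> y) \<le> d * norm y" for y
    unfolding d_def by (rule dual_bound[OF \<phi>])
  show ?thesis
  proof (cases "d * norm x = 0")
    case True
    then consider "d = 0" | "x = 0" by auto
    then have "\<phi> (T x) = 0"
    proof cases
      case 1
      then show ?thesis using b[of "T x"] by simp
    next
      case 2
      then show ?thesis using lT l\<phi> by (simp add: linear_simps)
    qed
    then show ?thesis using True[unfolded d_def] by (simp only: norm_zero mult_zero_right)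
  next
    case False
    have "0 \<le> d * norm x" using b[of x] norm_ge_zero order_trans by blast
    then have d: "d > 0" and x: "norm x > 0" "x \<noteq> 0" using False by (auto simp: zero_le_mult_iff)
    define \<psi> where "\<psi> y = of_real (1 / d) * \<phi> y" for y
    define u where "u = s (of_real (1 / norm x)) x"
    have u: "norm u = 1" using x by (simp add: u_def X.norm_scale norm_divide)
    have \<psi>u: "\<psi> u = 1"
      using d x \<phi> eq by (simp add: \<psi>_def u_def dual_scale d_def[symmetric])
    have \<psi>b: "norm (\<psi> y) \<le> norm y" for y
      using b[of y] d by (simp add: \<psi>_def norm_mult norm_divide field_simps)
    have "\<psi> \<in> dual (type_space s)"
      using \<phi> \<psi>b
      by (auto simp: dual_def bounded_maps_def type_space_def \<psi>_def algebra_simps intro!: exI[of _ 1])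
    moreover have "dual_norm (type_space s) \<psi> = 1"
      unfolding dual_norm_def op_norm_def
    proof (rule cSup_eq_maximum)
      show "1 \<in> (\<lambda>x. nrm (type_space (*)) (\<psi> x)) ` unit_ball (type_space s)"
        using u \<psi>u by (intro image_eqI[of _ _ u]) (auto simp: type_space_def unit_ball_def)
      fix r assume "r \<in> (\<lambda>x. nrm (type_space (*)) (\<psi> x)) ` unit_ball (type_space s)"
      then show "r \<le> 1"
        using \<psi>b by (auto simp: type_space_def unit_ball_def intro: order_trans)
    qed
    ultimately have "(u, \<psi>) \<in> state_pairs (type_space s)"
      using u \<psi>u by (simp add: state_pairs_def unit_sphere_def type_space_def)
    then have "norm (\<psi> (T u)) \<le> numerical_radius (type_space s) T"
      by (rule normed_nspace.le_numerical_radius[OF X.normed_nspace_type_space T])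
    moreover have "T u = s (of_real (1 / norm x)) (T x)"
      using T by (simp add: u_def bounded_maps_def type_space_def)
    ultimately have "norm (\<phi> (T x)) / (d * norm x) \<le> numerical_radius (type_space s) T"
      using d x \<phi> by (simp add: \<psi>_def dual_scale norm_mult norm_divide)
    then show ?thesis using d x by (simp add: d_def field_simps)
  qed
qed

text \<open>
  Equality in the chain \<open>1 = \<integral> Re \<Phi>(t)(f(t)) \<le> \<integral> \<bar>\<Phi>(t)(f(t))\<bar> \<le> \<integral> \<bar>\<Phi>\<bar>(t) \<parallel>f(t)\<parallel> \<le> 1\<close> forces
  equality of the integrands almost everywhere. In the scalar field the real part is
  \<open>inner z 1\<close>, and a scalar whose real part is at least its modulus is a nonnegative real.
\<close>

lemma norming_pointwise:
  assumes f: "f \<in> EX_fun M E" "nE (\<lambda>t. norm (f t)) \<le> 1"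
    and \<Phi>: "\<Phi> \<in> weakstar_dual M E nE s" "koethe_dual_norm M E nE (pt_norm s \<Phi>) \<le> 1"
    and int1: "(\<integral>t. \<Phi> t (f t) \<partial>M) = 1"
  shows "integrable M (\<lambda>t. norm (f t) * pt_norm s \<Phi> t)"
    and "(\<integral>t. norm (f t) * pt_norm s \<Phi> t \<partial>M) = 1"
    and "AE t in M. \<Phi> t (f t) = of_real (norm (f t) * pt_norm s \<Phi> t)"
proof -
  define q where "q t = norm (f t) * pt_norm s \<Phi> t" for t
  have pm: "pt_norm s \<Phi> \<in> borel_measurable M"
    using \<Phi> by (simp add: weakstar_dual_def koethe_dual_def L0_def)
  have le: "norm (\<Phi> t (f t)) \<le> q t" if "t \<in> space M" for t
    using dual_bound[of "\<Phi> t" "f t"] \<Phi> that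
    by (simp add: weakstar_dual_def q_def pt_norm_def mult.commute)
  have q: "integrable M q" "(\<integral>t. \<bar>q t\<bar> \<partial>M) \<le> 1"
    unfolding q_def using integrable_koethe_dual[OF EX_norm_mem[OF f(1)] pm \<Phi>(2)] f(2) by auto
  (* The integral of a function that is not integrable is 0 by convention, hence not 1. *)
  have z: "integrable M (\<lambda>t. \<Phi> t (f t))"
    using int1 not_integrable_integral_eq[of M "\<lambda>t. \<Phi> t (f t)"] by fastforce
  have one: "inner (1::'k) 1 = 1" by (simp flip: norm_eq_1)
  have re: "integrable M (\<lambda>t. inner (\<Phi> t (f t)) 1)" "(\<integral>t. inner (\<Phi> t (f t)) 1 \<partial>M) = 1"
    using z int1 by (auto simp: one)
  have re_le: "inner y 1 \<le> norm y" for y :: 'k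
    using norm_cauchy_schwarz[of y 1] by simp
  have ge: "AE t in M. 0 \<le> q t - inner (\<Phi> t (f t)) 1"
    using AE_space by eventually_elim (use le re_le in \<open>fastforce intro: order_trans\<close>)
  have qint: "(\<integral>t. q t \<partial>M) \<le> 1"
    using integral_abs_bound[of M q] q(2) by linarith
  have "0 \<le> (\<integral>t. q t - inner (\<Phi> t (f t)) 1 \<partial>M)" using ge by (rule integral_nonneg_AE)
  then have q1: "(\<integral>t. q t \<partial>M) = 1" using q re qint by simp
  then have "(\<integral>t. q t - inner (\<Phi> t (f t)) 1 \<partial>M) = 0" using q re by simp
  then have eq: "AE t in M. q t - inner (\<Phi> t (f t)) 1 = 0"
    using integral_nonneg_eq_0_iff_AE[OF _ ge] q re by auto
  have "AE t in M. \<Phi> t (f t) = of_real (q t)"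
    using eq AE_space
  proof eventually_elim
    case (elim t)
    let ?z = "\<Phi> t (f t)"
    have i: "inner ?z 1 = q t" and n: "norm ?z \<le> q t" using elim le[of t] by simp_all
    have "(norm (?z - of_real (q t)))\<^sup>2 = (norm ?z)\<^sup>2 - (q t)\<^sup>2"
      using i one unfolding power2_norm_eq_inner
      by (simp add: of_real_def inner_diff_left inner_diff_right inner_commute[of 1 ?z] power2_eq_square)
    also have "\<dots> \<le> 0" using n by (simp add: power_mono)
    finally show ?case by simp
  qed
  then show "integrable M (\<lambda>t. norm (f t) * pt_norm s \<Phi> t)"
    "(\<integral>t. norm (f t) * pt_norm s \<Phi> t \<partial>M) = 1"
    "AE t in M. \<Phi> t (f t) = of_real (norm (f t) * pt_norm s \<Phi> t)"
    using q(1) q1 by (simp_all add: q_def[abs_def])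
qed

text \<open>
  Let \<open>h = f + c (T \<circ> f)\<close>. The pointwise bound \<open>\<bar>\<Phi>\<bar> \<parallel>h\<parallel> \<ge> \<bar>\<Phi>(h)\<bar> \<ge> (1 - \<bar>c\<bar> w) \<bar>\<Phi>\<bar> \<parallel>f\<parallel>\<close> is integrated:
  the left side is at most the norm of \<open>h\<close> in \<open>E(X)\<close> by Koethe duality, and the right side
  gives \<open>1 - \<bar>c\<bar> w\<close> because \<open>\<bar>\<Phi>\<bar> \<parallel>f\<parallel>\<close> has integral one. Integrating
  \<open>0 \<le> \<bar>\<Phi>(T f)\<bar> \<le> w \<bar>\<Phi>\<bar> \<parallel>f\<parallel>\<close> gives \<open>0 \<le> w\<close>, which is not automatic: the numerical radius is
  undetermined on a space without states.
\<close>

lemma norming_lower_bound: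
  assumes T: "T \<in> bounded_maps (type_space s) (type_space s)"
    and f: "f \<in> EX_fun M E" "nE (\<lambda>t. norm (f t)) \<le> 1"
    and \<Phi>: "\<Phi> \<in> weakstar_dual M E nE s" "koethe_dual_norm M E nE (pt_norm s \<Phi>) \<le> 1"
    and int1: "(\<integral>t. \<Phi> t (f t) \<partial>M) = 1"
  shows "0 \<le> numerical_radius (type_space s) T"
    and "1 - norm c * numerical_radius (type_space s) T
          \<le> nE (\<lambda>t. norm (f t + s c (T (f t))))"
proof -
  define w where "w = numerical_radius (type_space s) T"
  define p where "p = pt_norm s \<Phi>"
  note np = norming_pointwise[OF f \<Phi> int1, folded p_def]
  have dual: "\<Phi> t \<in> dual (type_space s)" if "t \<in> space M" for t
    using \<Phi> that by (simp add: weakstar_dual_def)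
  have pm: "p \<in> borel_measurable M"
    using \<Phi> by (simp add: weakstar_dual_def koethe_dual_def L0_def p_def)
  have ae: "AE t in M. norm (\<Phi> t (T (f t))) \<le> w * (norm (f t) * p t)"
    using np(3) AE_space
  proof eventually_elim
    case (elim t)
    then show ?case
      using norm_le_numerical_radius_times[OF T dual, of t "f t"]
      by (simp add: w_def p_def pt_norm_def mult.commute)
  qed
  have "AE t in M. 0 \<le> w * (norm (f t) * p t)"
    using ae by eventually_elim (rule order_trans[OF norm_ge_zero])
  then have "0 \<le> (\<integral>t. w * (norm (f t) * p t) \<partial>M)" by (rule integral_nonneg_AE)
  then show "0 \<le> numerical_radius (type_space s) T" using np by (simp add: w_def)
  define h where "h t = f t + s c (T (f t))" for t
  have lT: "bounded_linear T"
    by (rule bounded_linear_bounded_maps[OF X.banach_over_axioms X.banach_over_axioms T])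
  have "\<exists>C. \<forall>x. norm (T x) \<le> C * norm x"
    using T by (simp add: bounded_maps_def type_space_def)
  then have "(\<lambda>t. T (f t)) \<in> EX_fun M E"
    using EX_bounded_linear(1)[OF f(1) lT] by blast
  then have h: "h \<in> EX_fun M E"
    unfolding h_def using f(1) by (intro EX_add EX_scale)
  have hp: "integrable M (\<lambda>t. norm (h t) * p t)" "(\<integral>t. \<bar>norm (h t) * p t\<bar> \<partial>M) \<le> nE (\<lambda>t. norm (h t))"
    using integrable_koethe_dual[OF EX_norm_mem[OF h] pm] \<Phi>(2) by (auto simp: p_def)
  have "AE t in M. (1 - norm c * w) * (norm (f t) * p t) \<le> norm (h t) * p t"
    using ae np(3) AE_space
  proof eventually_elim
    case (elim t)
    have d: "\<Phi> t \<in> dual (type_space s)" using elim dual by simp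
    have "norm (\<Phi> t (h t)) \<le> norm (h t) * p t"
      using dual_bound[OF d, of "h t"] by (simp add: p_def pt_norm_def mult.commute)
    moreover have "\<Phi> t (h t) = \<Phi> t (f t) + c * \<Phi> t (T (f t))"
      using dual_bounded_linear[OF d] d by (simp add: h_def dual_scale linear_simps)
    moreover have "norm (\<Phi> t (f t)) \<le> norm (\<Phi> t (f t) + c * \<Phi> t (T (f t))) + norm (c * \<Phi> t (T (f t)))"
      using norm_triangle_ineq4[of "\<Phi> t (f t) + c * \<Phi> t (T (f t))" "c * \<Phi> t (T (f t))"] by simp
    moreover have "norm (f t) * p t \<le> norm (\<Phi> t (f t))" using elim by (simp only: norm_of_real)
    moreover have "norm (c * \<Phi> t (T (f t))) \<le> norm c * (w * (norm (f t) * p t))"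
      using elim by (simp add: norm_mult mult_left_mono)
    ultimately show ?case by (simp add: algebra_simps)
  qed
  then have "(\<integral>t. (1 - norm c * w) * (norm (f t) * p t) \<partial>M) \<le> (\<integral>t. norm (h t) * p t \<partial>M)"
    using np(1) hp(1) by (intro integral_mono_AE) auto
  moreover have "(\<integral>t. norm (h t) * p t \<partial>M) \<le> (\<integral>t. \<bar>norm (h t) * p t\<bar> \<partial>M)"
    using hp(1) by (intro integral_mono) auto
  ultimately show "1 - norm c * numerical_radius (type_space s) T
          \<le> nE (\<lambda>t. norm (f t + s c (T (f t))))"
    using np(2) hp(2) by (simp add: w_def h_def)
qed

text \<open>
  By Koethe duality the pairing with \<open>\<Phi>\<close> has norm at most one on \<open>E(X)\<close>, and \<open>F\<close> shows that it
  has norm one. Additivity of the integral requires that \<open>\<Phi>(t)(f(t))\<close> is measurable for every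
  \<open>f\<close> in \<open>E(X)\<close>, not only for representatives of \<open>F\<close>.
\<close>

lemma pairing_state:
  assumes F: "F \<in> unit_sphere V"
    and \<Phi>: "\<Phi> \<in> weakstar_dual M E nE s" "koethe_dual_norm M E nE (pt_norm s \<Phi>) \<le> 1"
    and int1: "pairing M \<Phi> F = 1"
  shows "(F, pairing M \<Phi>) \<in> state_pairs V"
proof -
  have dual: "\<Phi> t \<in> dual (type_space s)" if "t \<in> space M" for t
    using \<Phi> that by (simp add: weakstar_dual_def)
  have pm: "pt_norm s \<Phi> \<in> borel_measurable M"
    using \<Phi> by (simp add: weakstar_dual_def koethe_dual_def L0_def)
  have int: "integrable M (\<lambda>t. \<Phi> t (f t))"
    and bound: "norm (\<integral>t. \<Phi> t (f t) \<partial>M) \<le> nE (\<lambda>t. norm (f t))" if f: "f \<in> EX_fun M E" for f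
  proof -
    have q: "integrable M (\<lambda>t. norm (f t) * pt_norm s \<Phi> t)"
      "(\<integral>t. \<bar>norm (f t) * pt_norm s \<Phi> t\<bar> \<partial>M) \<le> nE (\<lambda>t. norm (f t))"
      using integrable_koethe_dual[OF EX_norm_mem[OF f] pm \<Phi>(2)] by auto
    have le: "norm (\<Phi> t (f t)) \<le> \<bar>norm (f t) * pt_norm s \<Phi> t\<bar>" if "t \<in> space M" for t
      using dual_bound[OF dual[OF that], of "f t"] by (simp add: pt_norm_def mult.commute)
    have meas: "(\<lambda>t. \<Phi> t (f t)) \<in> borel_measurable M"
    proof (rule borel_measurable_weakstar_pairing[OF EX_strongly_measurable[OF f]])
      show "(\<lambda>t. \<Phi> t x) \<in> borel_measurable M" for x
        using \<Phi>(1) by (simp add: weakstar_dual_def)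
    qed (rule dual_bounded_linear[OF dual])
    show I: "integrable M (\<lambda>t. \<Phi> t (f t))"
      by (rule Bochner_Integration.integrable_bound[OF q(1) meas]) (use le in auto)
    have "norm (\<integral>t. \<Phi> t (f t) \<partial>M) \<le> (\<integral>t. norm (\<Phi> t (f t)) \<partial>M)"
      by (rule integral_norm_bound)
    also have "\<dots> \<le> (\<integral>t. \<bar>norm (f t) * pt_norm s \<Phi> t\<bar> \<partial>M)"
      using I q(1) le by (intro integral_mono) auto
    finally show "norm (\<integral>t. \<Phi> t (f t) \<partial>M) \<le> nE (\<lambda>t. norm (f t))" using q(2) by simp
  qed
  have cls: "pairing M \<Phi> (cls f) = (\<integral>t. \<Phi> t (f t) \<partial>M)" if f: "f \<in> EX_fun M E" for f
    unfolding pairing_def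
  proof (rule integral_cong_AE)
    show "AE t in M. \<Phi> t (rep (cls f) t) = \<Phi> t (f t)"
      using rep_cls(2)[OF f] by eventually_elim simp
  qed (use int f rep_cls(1) in auto)
  have le: "norm (pairing M \<Phi> x) \<le> nrm V x" if "x \<in> carr V" for x
    using that by (elim carrE) (simp add: cls bound nrm_cls)
  have "pairing M \<Phi> \<in> dual V"
    unfolding dual_def bounded_maps_def
  proof (intro CollectI conjI ballI allI)
    fix x c assume x: "x \<in> carr V"
    obtain f where f: "f \<in> EX_fun M E" "x = cls f" using carrE[OF x] .
    have "(\<integral>t. \<Phi> t (s c (f t)) \<partial>M) = (\<integral>t. c * \<Phi> t (f t) \<partial>M)"
      by (intro Bochner_Integration.integral_cong) (simp_all add: dual dual_scale)
    then show "pairing M \<Phi> (scl V c x) = scl (type_space (*)) c (pairing M \<Phi> x)"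
      using f by (simp add: scl_cls cls EX_scale type_space_def)
    fix y assume y: "y \<in> carr V"
    obtain g where g: "g \<in> EX_fun M E" "y = cls g" using carrE[OF y] .
    have "(\<integral>t. \<Phi> t (f t + g t) \<partial>M) = (\<integral>t. \<Phi> t (f t) + \<Phi> t (g t) \<partial>M)"
      by (intro Bochner_Integration.integral_cong) (simp_all add: dual dual_bounded_linear linear_simps)
    then show "pairing M \<Phi> (add V x y) = add (type_space (*)) (pairing M \<Phi> x) (pairing M \<Phi> y)"
      using f g by (simp add: add_cls cls EX_add(1) int type_space_def)
  next
    show "\<exists>C. \<forall>x\<in>carr V. nrm (type_space (*)) (pairing M \<Phi> x) \<le> C * nrm V x"
      using le by (auto simp: type_space_def intro!: exI[of _ 1])
  qed (simp add: type_space_def)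
  moreover have "dual_norm V (pairing M \<Phi>) = 1"
    unfolding dual_norm_def op_norm_def
  proof (rule cSup_eq_maximum)
    show "1 \<in> (\<lambda>x. nrm (type_space (*)) (pairing M \<Phi> x)) ` unit_ball V"
      using F int1 by (intro image_eqI[of _ _ F]) (auto simp: type_space_def unit_ball_def unit_sphere_def)
    fix r assume "r \<in> (\<lambda>x. nrm (type_space (*)) (pairing M \<Phi> x)) ` unit_ball V"
    then show "r \<le> 1"
      using le by (auto simp: type_space_def unit_ball_def intro: order_trans)
  qed
  ultimately show ?thesis using F int1 by (simp add: state_pairs_def)
qed

section \<open>Pointwise action of an operator\<close>

definition lift :: "('x \<Rightarrow> 'x) \<Rightarrow> ('a \<Rightarrow> 'x) set \<Rightarrow> ('a \<Rightarrow> 'x) set" where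
  "lift T F = cls (\<lambda>t. T (rep F t))"

context
  fixes T :: "'x \<Rightarrow> 'x"
  assumes T: "T \<in> bounded_maps (type_space s) (type_space s)"
begin

lemma bounded_linear_T: "bounded_linear T"
  by (rule bounded_linear_bounded_maps[OF X.banach_over_axioms X.banach_over_axioms T])

lemma norm_T_le: "norm (T x) \<le> op_norm (type_space s) (type_space s) T * norm x"
  using normed_nspace.nrm_le_op_norm[OF X.normed_nspace_type_space X.normed_nspace_type_space T, of x]
  by (simp add: type_space_def)

lemma EX_T: "f \<in> EX_fun M E \<Longrightarrow> (\<lambda>t. T (f t)) \<in> EX_fun M E"
  by (rule EX_bounded_linear[OF _ bounded_linear_T norm_T_le])

lemma lift_cls:
  assumes f: "f \<in> EX_fun M E"
  shows "lift T (cls f) = cls (\<lambda>t. T (f t))"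
  unfolding lift_def
proof (rule cls_eqI)
  show "AE t in M. T (rep (cls f) t) = T (f t)"
    using rep_cls(2)[OF f] by eventually_elim simp
qed (use f in \<open>simp_all add: EX_T rep_cls\<close>)

lemma nrm_lift_le:
  assumes "x \<in> carr V"
  shows "nrm V (lift T x) \<le> \<bar>op_norm (type_space s) (type_space s) T\<bar> * nrm V x"
  using assms
  by (elim carrE)
     (simp add: lift_cls nrm_cls EX_T EX_bounded_linear(2)[OF _ bounded_linear_T norm_T_le])

lemma lift_bounded_maps: "lift T \<in> bounded_maps V V"
  unfolding bounded_maps_def
proof (intro CollectI conjI ballI allI)
  fix x c assume x: "x \<in> carr V"
  obtain f where f: "f \<in> EX_fun M E" "x = cls f" using carrE[OF x] .
  show "lift T x \<in> carr V" using f by (simp add: lift_cls EX_T cls_mem)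
  show "lift T (scl V c x) = scl V c (lift T x)"
    using f T by (simp add: lift_cls scl_cls EX_T EX_scale bounded_maps_def type_space_def)
  fix y assume y: "y \<in> carr V"
  obtain g where g: "g \<in> EX_fun M E" "y = cls g" using carrE[OF y] .
  show "lift T (add V x y) = add V (lift T x) (lift T y)"
    using f g T by (simp add: lift_cls add_cls EX_T EX_add(1) bounded_maps_def type_space_def)
next
  show "\<exists>C. \<forall>x\<in>carr V. nrm V (lift T x) \<le> C * nrm V x"
    using nrm_lift_le by blast
qed

end

text \<open>
  A function \<open>e\<close> of this kind turns \<open>x \<mapsto> e x\<close> into an isometric embedding of \<open>X\<close> into \<open>E(X)\<close>. It
  is a multiple of the indicator of a set of positive finite measure, which exists because the
  measure is \<open>\<sigma>\<close>-finite and not zero.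
\<close>

lemma unit_simple_function:
  assumes "sigma_finite_measure M" "emeasure M (space M) \<noteq> 0"
  obtains e where "e \<in> E" "simple_function M e" "\<And>t. 0 \<le> e t" "nE e = 1"
proof -
  interpret sigma_finite_measure M by fact
  have "\<exists>A\<in>sets M. 0 < emeasure M A \<and> emeasure M A < \<infinity>"
  proof -
    obtain Z where "Z \<in> sets M" "emeasure M Z < \<infinity>" "emeasure M Z > 0"
    proof (cases "emeasure M (space M) = \<infinity>")
      case True
      obtain Z where "Z \<in> sets M" "emeasure M Z < \<infinity>" "emeasure M Z > ennreal 0"
        using approx_PInf_emeasure_with_finite[of "space M" 0] True by auto
      then show ?thesis using that by auto
    next
      case False
      then show ?thesis
        using assms(2) that[of "space M"] by (auto simp: less_top zero_less_iff_neq_zero)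
    qed
    then show ?thesis by blast
  qed
  then obtain A where A: "A \<in> sets M" "0 < emeasure M A" "emeasure M A < \<infinity>" by blast
  have mem: "indicator A \<in> E" using E.indicator_mem A by blast
  have "\<not> (AE t in M. indicator A t = (0::real))"
    using A null_sets_iff_AE[of A] sets.sets_into_space[OF A(1)]
    by (auto simp: indicator_eq_0_iff null_sets_def)
  then have r: "nE (indicator A) > 0"
    using E.norm_eq_0_iff[OF mem] E.norm_nonneg[OF mem] by fastforce
  show thesis
  proof (rule that[of "\<lambda>t. 1 / nE (indicator A) * indicator A t"])
    show "(\<lambda>t. 1 / nE (indicator A) * indicator A t) \<in> E" by (rule E.scale_mem[OF mem])
    show "nE (\<lambda>t. 1 / nE (indicator A) * indicator A t) = 1"
      using r by (subst E.norm_scale[OF mem]) simp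
    show "simple_function M (\<lambda>t. 1 / nE (indicator A) * indicator A t)"
      using A by (intro simple_function_mult) auto
    show "0 \<le> 1 / nE (indicator A) * indicator A t" for t using r by simp
  qed
qed

lemma elementary_mem:
  assumes e: "e \<in> E" "simple_function M e" "\<And>t. 0 \<le> e t" "nE e = 1"
  shows "(\<lambda>t. e t *\<^sub>R x) \<in> EX_fun M E" and "nE (\<lambda>t. norm (e t *\<^sub>R x)) = norm x"
proof -
  have n: "(\<lambda>t. norm (e t *\<^sub>R x)) = (\<lambda>t. norm x * e t)" using e by (simp add: mult.commute)
  have "simple_function M (\<lambda>t. e t *\<^sub>R x)"
    using simple_function_compose[OF e(2), of "\<lambda>r. r *\<^sub>R x"] by (simp add: comp_def)
  then have "strongly_measurable M (\<lambda>t. e t *\<^sub>R x)"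
    unfolding strongly_measurable_def by (intro exI[of _ "\<lambda>n t. e t *\<^sub>R x"]) simp
  then show "(\<lambda>t. e t *\<^sub>R x) \<in> EX_fun M E"
    using E.scale_mem[OF e(1)] by (simp add: EX_fun_def n del: norm_scaleR)
  show "nE (\<lambda>t. norm (e t *\<^sub>R x)) = norm x"
    using E.norm_scale[OF e(1), of "norm x"] e(4) unfolding n by simp
qed

text \<open>
  The inequality \<open>\<ge>\<close> holds because \<open>lift T\<close> maps the copy \<open>e X\<close> of \<open>X\<close> in \<open>E(X)\<close> to itself and acts
  there as \<open>T\<close>.
\<close>

lemma op_norm_lift:
  assumes T: "T \<in> bounded_maps (type_space s) (type_space s)"
    and T1: "op_norm (type_space s) (type_space s) T = 1"
    and M: "sigma_finite_measure M" "emeasure M (space M) \<noteq> 0"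
  shows "op_norm V V (lift T) = 1"
proof (rule antisym)
  obtain e where e: "e \<in> E" "simple_function M e" "\<And>t. 0 \<le> e t" "nE e = 1"
    by (rule unit_simple_function[OF M]) blast
  note el = elementary_mem[OF e]
  have "cls (\<lambda>t. e t *\<^sub>R 0) \<in> unit_ball V"
    by (simp only: unit_ball_def mem_Collect_eq cls_mem nrm_cls el norm_zero zero_le_one simp_thms)
  then show "op_norm V V (lift T) \<le> 1"
    unfolding op_norm_def
    by (intro cSUP_least) (use nrm_lift_le[OF T] T1 in \<open>force simp: unit_ball_def\<close>)+
  have "norm (T x) \<le> op_norm V V (lift T)" if x: "norm x \<le> 1" for x
  proof -
    have "(\<lambda>t. T (e t *\<^sub>R x)) = (\<lambda>t. e t *\<^sub>R T x)"
      using bounded_linear_T[OF T] by (simp add: linear_simps)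
    then have "norm (T x) = nrm V (lift T (cls (\<lambda>t. e t *\<^sub>R x)))"
      using el[of x] el[of "T x"] by (simp add: lift_cls[OF T] nrm_cls del: norm_scaleR)
    also have "\<dots> \<le> op_norm V V (lift T)"
      unfolding op_norm_def
      using el[of x] x
      by (intro cSUP_upper bdd_above_op lift_bounded_maps T)
         (simp add: unit_ball_def cls_mem nrm_cls del: norm_scaleR)
    finally show ?thesis .
  qed
  then have "op_norm (type_space s) (type_space s) T \<le> op_norm V V (lift T)"
    unfolding op_norm_def[of "type_space s"]
    by (intro cSUP_least) (auto simp: unit_ball_def type_space_def intro!: exI[of _ 0])
  then show "1 \<le> op_norm V V (lift T)" using T1 by simp
qed

section \<open>Comparison of the numerical indices\<close>

lemma numerical_radius_lift_le:
  assumes T: "T \<in> bounded_maps (type_space s) (type_space s)"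
    and AS: "A \<subseteq> unit_sphere V" and ne: "A \<noteq> {}"
    and dense: "\<forall>F\<in>unit_sphere V. \<forall>e>0. \<exists>G\<in>A. ndist V F G < e"
    and norming: "\<forall>F\<in>A. \<exists>\<Phi>\<in>weakstar_dual M E nE s.
           koethe_dual_norm M E nE (pt_norm s \<Phi>) \<le> 1 \<and> pairing M \<Phi> F = 1"
  shows "numerical_radius V (lift T) \<le> numerical_radius (type_space s) T"
proof (rule numerical_radius_le_from_lower_bounds[OF lift_bounded_maps[OF T]])
  let ?w = "numerical_radius (type_space s) T"
  have *: "0 \<le> ?w" "1 - norm c * ?w \<le> nrm V (add V F (scl V c (lift T F)))"
    "state_pairs V \<noteq> {}" if "F \<in> A" for F c
  proof -
    obtain \<Phi> where \<Phi>: "\<Phi> \<in> weakstar_dual M E nE s"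
        "koethe_dual_norm M E nE (pt_norm s \<Phi>) \<le> 1" "pairing M \<Phi> F = 1"
      using norming \<open>F \<in> A\<close> by blast
    have F: "F \<in> carr V" "nrm V F = 1" using AS \<open>F \<in> A\<close> by (auto simp: unit_sphere_def)
    define f where "f = rep F"
    have f: "f \<in> EX_fun M E" "nE (\<lambda>t. norm (f t)) \<le> 1" "(\<integral>t. \<Phi> t (f t) \<partial>M) = 1"
      using F \<Phi>(3) by (auto simp: f_def rep_mem nrm_rep pairing_def)
    note lb = norming_lower_bound[OF T f(1,2) \<Phi>(1,2) f(3)]
    show "0 \<le> ?w" by (rule lb)
    have "F = cls f" using F by (simp add: f_def cls_rep)
    then show "1 - norm c * ?w \<le> nrm V (add V F (scl V c (lift T F)))"
      using f(1) lb(2)[of c]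
      by (simp add: lift_cls[OF T] scl_cls add_cls nrm_cls EX_T[OF T] EX_scale EX_add(1))
    show "state_pairs V \<noteq> {}" using pairing_state[OF _ \<Phi>] AS \<open>F \<in> A\<close> by blast
  qed
  show "0 \<le> ?w" "state_pairs V \<noteq> {}" using * ne by blast+
  show "(1 - norm c * ?w) * nrm V x \<le> nrm V (add V x (scl V c (lift T x)))" if "x \<in> carr V" for c x
    using lower_bound_from_dense[OF lift_bounded_maps[OF T] AS dense *(2) that] by blast
qed

end

theorem theorem4p1:
  fixes M :: "'a measure"
    and E :: "('a \<Rightarrow> real) set" and nE :: "('a \<Rightarrow> real) \<Rightarrow> real"
    and s :: "'k::{real_normed_field,euclidean_space} \<Rightarrow> 'x::banach \<Rightarrow> 'x"
    and \<A> :: "('a \<Rightarrow> 'x) set set"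
  assumes "complete_measure M" and "sigma_finite_measure M"
    and "emeasure M (space M) \<noteq> 0"
    and "koethe_space M E nE"
    and "banach_over s"
    and "\<A> \<subseteq> unit_sphere (EX_space M E nE s)"
    and "\<forall>F\<in>unit_sphere (EX_space M E nE s). \<forall>e>0. \<exists>G\<in>\<A>. ndist (EX_space M E nE s) F G < e"
    and "\<forall>F\<in>\<A>. \<exists>\<Phi>\<in>weakstar_dual M E nE s.
           koethe_dual_norm M E nE (pt_norm s \<Phi>) = 1 \<and> pairing M \<Phi> F = 1"
  shows "numerical_index (EX_space M E nE s) \<le> numerical_index (type_space s)"
proof -
  interpret koethe_bochner M E nE s using assms by (simp add: koethe_bochner_def)
  obtain e where e: "e \<in> E" "simple_function M e" "\<And>t. 0 \<le> e t" "nE e = 1"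
    by (rule unit_simple_function[OF assms(2,3)]) blast
  note el = elementary_mem[OF e]
  show ?thesis
  proof (cases "\<exists>x::'x. x \<noteq> 0")
    (* For X = {0} the space E(X) is zero as well, and both infima are over the empty set. *)
    case False
    then have X0: "norm x = 0" for x :: 'x by simp
    have "nE (\<lambda>_. 0) = 0" using E.norm_eq_0_iff[OF E.zero_mem] by simp
    then have "numerical_index V = Inf {}"
      using el(1) by (intro numerical_index_trivial) (auto simp: X0 dest: cls_mem simp flip: nrm_rep)
    moreover have "numerical_index (type_space s) = Inf {}"
      by (intro normed_nspace.numerical_index_trivial X.normed_nspace_type_space)
         (use X0 in \<open>auto simp: type_space_def\<close>)
    ultimately show ?thesis by simp
  next
    case True
    then obtain x0 :: 'x where "x0 \<noteq> 0" by blast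
    define u where "u = x0 /\<^sub>R norm x0"
    have u: "norm u = 1" using \<open>x0 \<noteq> 0\<close> by (simp add: u_def)
    have "cls (\<lambda>t. e t *\<^sub>R u) \<in> unit_sphere V"
      using el[of u] u by (simp add: unit_sphere_def cls_mem nrm_cls del: norm_scaleR)
    then obtain G where G: "G \<in> \<A>" using assms(7) zero_less_one by blast
    then obtain \<Phi> where "\<Phi> \<in> weakstar_dual M E nE s"
        "koethe_dual_norm M E nE (pt_norm s \<Phi>) = 1" "pairing M \<Phi> G = 1"
      using assms(8) by blast
    then have states: "state_pairs V \<noteq> {}"
      using pairing_state[of G \<Phi>] G assms(6) by auto
    show ?thesis
      unfolding numerical_index_def[of "type_space s"]
    proof (rule cINF_greatest)
      have "op_norm (type_space s) (type_space s) (\<lambda>x. x) = 1"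
        unfolding op_norm_def
        by (rule cSup_eq_maximum)
           (use u in \<open>auto simp: unit_ball_def type_space_def intro!: image_eqI[of _ _ u]\<close>)
      moreover have "(\<lambda>x. x) \<in> bounded_maps (type_space s) (type_space s)"
        by (auto simp: bounded_maps_def type_space_def intro: exI[of _ 1])
      ultimately show "{T \<in> bounded_maps (type_space s) (type_space s).
          op_norm (type_space s) (type_space s) T = 1} \<noteq> {}" by blast
      fix T assume "T \<in> {T \<in> bounded_maps (type_space s) (type_space s).
          op_norm (type_space s) (type_space s) T = 1}"
      then have T: "T \<in> bounded_maps (type_space s) (type_space s)"
        "op_norm (type_space s) (type_space s) T = 1" by auto
      have "numerical_index V \<le> numerical_radius V (lift T)"
        using T assms(2,3) states by (intro numerical_index_le lift_bounded_maps op_norm_lift)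
      also have "\<dots> \<le> numerical_radius (type_space s) T"
      proof (rule numerical_radius_lift_le[OF T(1) assms(6) _ assms(7)])
        show "\<A> \<noteq> {}" using G by auto
        show "\<forall>F\<in>\<A>. \<exists>\<Phi>\<in>weakstar_dual M E nE s.
           koethe_dual_norm M E nE (pt_norm s \<Phi>) \<le> 1 \<and> pairing M \<Phi> F = 1"
        proof
          fix F assume "F \<in> \<A>"
          then obtain \<Phi> where "\<Phi> \<in> weakstar_dual M E nE s"
              "koethe_dual_norm M E nE (pt_norm s \<Phi>) = 1" "pairing M \<Phi> F = 1"
            using assms(8) by blast
          then show "\<exists>\<Phi>\<in>weakstar_dual M E nE s.
             koethe_dual_norm M E nE (pt_norm s \<Phi>) \<le> 1 \<and> pairing M \<Phi> F = 1"
            by (intro bexI[of _ \<Phi>]) simp_all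
        qed
      qed
      finally show "numerical_index V \<le> numerical_radius (type_space s) T" .
    qed
  qed
qed

end
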